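(* Let $n\ge 2$ and let $\Pi_0,\dots,\Pi_n\subset\mathbb{P}^n$ be general linear subspaces of codimension $2$. With the matrices $C_i$ defined in the context, the homomorphism $\lambda:K[x_0,\dots,x_n]\to K[y_0,\dots,y_n]$ given by $\lambda(x_i)=\det(C_i)$, $i=0,\dots,n$, defines a birational map $u_n:\mathbb{P}^n\dashrightarrow\mathbb{P}^n$ (that is, $u_n=(\det C_0:\dots:\det C_n)$, from the $\mathbb{P}^n$ with coordinates $y_i$ to the $\mathbb{P}^n$ with coordinates $x_i$) which is inverse to $v_n$.
   Context: $\mathbb{P}^n$ is projective space over a ground field $K$ of characteristic $0$; points and lines are understood geometrically (i.e. over an algebraic closure if $K$ is not algebraically closed). "General" means: for all choices in some dense Zariski-open subset of the parameter space. Coordinates $x_0,\dots,x_n$ on $\mathbb{P}^n$ are chosen so that the ideal of $\Pi_i$ is $(x_i,f_i)$ with $f_i=\sum_{j\neq i}a_{i,j}x_j$ and $a_{i,j}\neq 0$ for all $i\neq j$. Let $B$ be the $(n+1)\times(n+1)$ matrix, with rows and columns indexed by $0,\dots,n$, whose $(i,i)$ entry is $-f_i$ and whose $(i,j)$ entry for $i\ne j$ is $a_{i,j}x_j$; let $B_i$ be obtained from $B$ by deleting row $i$ and column $i$. Then $\det(B_i)=x_iQ_i$, where $Q_i$ is a form of degree $n-1$ defining the unique hypersurface of degree $n-1$ containing all $\Pi_j$ with $j\neq i$. $\mathcal{L}_n$ is the vector space of forms of degree $n$ vanishing on $\Pi_0\cup\dots\cup\Pi_n$; the forms $x_0Q_0,\dots,x_nQ_n$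 are a basis of it. The rational map $v_n:\mathbb{P}^n\dashrightarrow\mathbb{P}^n$ is $(x_0:\dots:x_n)\mapsto(x_0Q_0:\dots:x_nQ_n)$, the target having homogeneous coordinates $y_0,\dots,y_n$. Since $f_iQ_i\in\mathcal{L}_n$, there are unique scalars $b_{i,j}$ with $f_iQ_i=b_{i,0}x_0Q_0+\dots+b_{i,n}x_nQ_n$; put $g_i=b_{i,0}y_0+\dots+b_{i,n}y_n$. Let $C$ be the $(n+1)\times(n+1)$ matrix whose $(i,i)$ entry is $-g_i$ and whose $(i,j)$ entry for $i\neq j$ is $a_{i,j}y_j$, and let $C_i$ be obtained from $C$ by deleting row $i$ and column $i$. *)

theory Defs
  imports
    "HOL-Library.Poly_Mapping"
    "HOL-Library.FuncSet"
    "Jordan_Normal_Form.Determinant"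
begin

section \<open>Multivariate polynomials\<close>

text \<open>Polynomials with coefficients in \<open>'a\<close> and variables indexed by \<open>'x\<close>: finitely supported
  functions from monomials (finitely supported exponent functions) to coefficients. The product
  of \<^theory>\<open>HOL-Library.Poly_Mapping\<close> is the convolution product, i.e. multiplication of polynomials.\<close>

type_synonym ('x, 'a) mpoly = "('x \<Rightarrow>\<^sub>0 nat) \<Rightarrow>\<^sub>0 'a"

definition Const :: "'a::zero \<Rightarrow> ('x, 'a) mpoly" where
  "Const c = Poly_Mapping.single 0 c"

definition Var :: "'x \<Rightarrow> ('x, 'a::zero_neq_one) mpoly" where
  "Var i = Poly_Mapping.single (Poly_Mapping.single i 1) 1"

definition poly_eval :: "('x \<Rightarrow> 'a) \<Rightarrow> ('x, 'a::comm_ring_1) mpoly \<Rightarrow> 'a" where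
  "poly_eval \<sigma> F = (\<Sum>m\<in>Poly_Mapping.keys F. Poly_Mapping.lookup F m *
     (\<Prod>i\<in>Poly_Mapping.keys m. \<sigma> i ^ Poly_Mapping.lookup m i))"

text \<open>The homomorphism of \<open>K\<close>-algebras that sends \<^term>\<open>Var i\<close> to \<open>G i\<close>.\<close>

definition poly_subst ::
  "('x \<Rightarrow> ('y, 'a) mpoly) \<Rightarrow> ('x, 'a::comm_ring_1) mpoly \<Rightarrow> ('y, 'a) mpoly" where
  "poly_subst G F = (\<Sum>m\<in>Poly_Mapping.keys F. Const (Poly_Mapping.lookup F m) *
     (\<Prod>i\<in>Poly_Mapping.keys m. G i ^ Poly_Mapping.lookup m i))"

lemma poly_subst_Var: "poly_subst G (Var i) = G i"
  by (simp add: poly_subst_def Var_def Const_def)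

text \<open>The subring \<open>K[x\<^sub>0,\<dots>,x\<^sub>n]\<close> of the ring of polynomials in \<open>x\<^sub>0,x\<^sub>1,\<dots>\<close>.\<close>

definition polys :: "nat \<Rightarrow> (nat, 'a::zero) mpoly set" where
  "polys n = {F. \<forall>m\<in>Poly_Mapping.keys F. Poly_Mapping.keys m \<subseteq> {..n}}"

definition form :: "nat \<Rightarrow> nat \<Rightarrow> (nat, 'a::zero) mpoly \<Rightarrow> bool" where
  "form n d F \<longleftrightarrow> F \<in> polys n \<and>
     (\<forall>m\<in>Poly_Mapping.keys F. (\<Sum>i\<in>Poly_Mapping.keys m. Poly_Mapping.lookup m i) = d)"


section \<open>Rational maps from projective n-space to itself\<close>

text \<open>A rational map is represented by forms \<open>F\<^sub>0,\<dots>,F\<^sub>n\<close> of the same degree, not all zero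
  (values at indices above \<open>n\<close> are ignored); two representatives give the same rational map iff
  they are proportional over \<open>K(x\<^sub>0,\<dots>,x\<^sub>n)\<close>.\<close>

definition rational_map :: "nat \<Rightarrow> (nat \<Rightarrow> (nat, 'a::zero) mpoly) \<Rightarrow> bool" where
  "rational_map n F \<longleftrightarrow> (\<exists>d. \<forall>i\<le>n. form n d (F i)) \<and> (\<exists>i\<le>n. F i \<noteq> 0)"

definition same_rational_map ::
  "nat \<Rightarrow> (nat \<Rightarrow> (nat, 'a::comm_ring_1) mpoly) \<Rightarrow> (nat \<Rightarrow> (nat, 'a) mpoly) \<Rightarrow> bool" where
  "same_rational_map n F G \<longleftrightarrow> (\<forall>i\<le>n. \<forall>j\<le>n. F i * G j = F j * G i)"

text \<open>The composite \<open>G \<circ> F\<close>. It is a rational map only if not all components vanish.\<close>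

definition rat_comp ::
  "(nat \<Rightarrow> (nat, 'a::comm_ring_1) mpoly) \<Rightarrow> (nat \<Rightarrow> (nat, 'a) mpoly) \<Rightarrow> nat \<Rightarrow> (nat, 'a) mpoly" where
  "rat_comp G F = (\<lambda>i. poly_subst F (G i))"

definition inverse_rational_maps ::
  "nat \<Rightarrow> (nat \<Rightarrow> (nat, 'a::comm_ring_1) mpoly) \<Rightarrow> (nat \<Rightarrow> (nat, 'a) mpoly) \<Rightarrow> bool" where
  "inverse_rational_maps n F G \<longleftrightarrow>
     rational_map n F \<and> rational_map n G \<and>
     rational_map n (rat_comp G F) \<and> same_rational_map n (rat_comp G F) Var \<and>
     rational_map n (rat_comp F G) \<and> same_rational_map n (rat_comp F G) Var"

definition birational :: "nat \<Rightarrow> (nat \<Rightarrow> (nat, 'a::comm_ring_1) mpoly) \<Rightarrow> bool" where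
  "birational n F \<longleftrightarrow> (\<exists>G. inverse_rational_maps n F G)"

text \<open>The map \<open>(\<phi>(x\<^sub>0) : \<dots> : \<phi>(x\<^sub>n))\<close> given by an endomorphism \<open>\<phi>\<close> of the polynomial ring.\<close>

definition map_of_hom ::
  "((nat, 'a::zero_neq_one) mpoly \<Rightarrow> (nat, 'a) mpoly) \<Rightarrow> nat \<Rightarrow> (nat, 'a) mpoly" where
  "map_of_hom \<phi> = (\<lambda>i. \<phi> (Var i))"


section \<open>Tuples of codimension 2 subspaces and their Zariski topology\<close>

text \<open>A linear subspace of projective \<open>n\<close>-space is given by its affine cone in \<open>K\<^sup>n\<^sup>+\<^sup>1\<close>;
  it has codimension 2 iff it is cut out by two linearly independent linear forms.\<close>

definition indep2 :: "nat \<Rightarrow> 'a::comm_ring_1 vec \<Rightarrow> 'a vec \<Rightarrow> bool" where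
  "indep2 n l m \<longleftrightarrow> (\<forall>s t. s \<cdot>\<^sub>v l + t \<cdot>\<^sub>v m = 0\<^sub>v (Suc n) \<longrightarrow> s = 0 \<and> t = 0)"

definition zero_locus2 :: "nat \<Rightarrow> 'a::comm_ring_1 vec \<Rightarrow> 'a vec \<Rightarrow> 'a vec set" where
  "zero_locus2 n l m = {p \<in> carrier_vec (Suc n). l \<bullet> p = 0 \<and> m \<bullet> p = 0}"

definition codim2_subspaces :: "nat \<Rightarrow> 'a::comm_ring_1 vec set set" where
  "codim2_subspaces n =
     {zero_locus2 n l m | l m. l \<in> carrier_vec (Suc n) \<and> m \<in> carrier_vec (Suc n) \<and> indep2 n l m}"

definition param_space :: "nat \<Rightarrow> (nat \<Rightarrow> 'a::comm_ring_1 vec set) set" where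
  "param_space n = {..n} \<rightarrow>\<^sub>E codim2_subspaces n"

text \<open>The parameter space is a product of \<open>n + 1\<close> Grassmannians. A frame assigns to each index
  \<open>i\<close> a pair (\<open>k = 0, 1\<close>) of independent linear forms with coefficients \<open>c (i, k, j)\<close>. The space
  of frames is open in an affine space, and the product of Grassmannians carries the quotient
  topology of its Zariski topology, the frames being locally trivial over it.\<close>

definition frame_form :: "nat \<Rightarrow> (nat \<times> nat \<times> nat \<Rightarrow> 'a) \<Rightarrow> nat \<Rightarrow> nat \<Rightarrow> 'a vec" where
  "frame_form n c i k = vec (Suc n) (\<lambda>j. c (i, k, j))"

definition is_frame :: "nat \<Rightarrow> (nat \<times> nat \<times> nat \<Rightarrow> 'a::comm_ring_1) \<Rightarrow> bool" where
  "is_frame n c \<longleftrightarrow> (\<forall>i\<le>n. indep2 n (frame_form n c i 0) (frame_form n c i 1))"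

definition frame_tuple ::
  "nat \<Rightarrow> (nat \<times> nat \<times> nat \<Rightarrow> 'a::comm_ring_1) \<Rightarrow> nat \<Rightarrow> 'a vec set" where
  "frame_tuple n c = (\<lambda>i\<in>{..n}. zero_locus2 n (frame_form n c i 0) (frame_form n c i 1))"

definition zariski_open :: "nat \<Rightarrow> (nat \<Rightarrow> 'a::comm_ring_1 vec set) set \<Rightarrow> bool" where
  "zariski_open n U \<longleftrightarrow> U \<subseteq> param_space n \<and>
     (\<exists>S :: (nat \<times> nat \<times> nat, 'a) mpoly set. \<forall>c. is_frame n c \<longrightarrow>
        (frame_tuple n c \<in> U \<longleftrightarrow> (\<exists>P\<in>S. poly_eval c P \<noteq> 0)))"

definition zariski_dense :: "nat \<Rightarrow> (nat \<Rightarrow> 'a::comm_ring_1 vec set) set \<Rightarrow> bool" where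
  "zariski_dense n U \<longleftrightarrow> (\<forall>V. zariski_open n V \<longrightarrow> V \<noteq> {} \<longrightarrow> U \<inter> V \<noteq> {})"


section \<open>Adapted coordinates\<close>

definition lin_f :: "nat \<Rightarrow> (nat \<Rightarrow> nat \<Rightarrow> 'a::comm_ring_1) \<Rightarrow> nat \<Rightarrow> (nat, 'a) mpoly" where
  "lin_f n a i = (\<Sum>j\<in>{..n} - {i}. Const (a i j) * Var j)"

definition vanishing_ideal :: "nat \<Rightarrow> 'a::comm_ring_1 vec set \<Rightarrow> (nat, 'a) mpoly set" where
  "vanishing_ideal n S = {F \<in> polys n. \<forall>p\<in>S. poly_eval (\<lambda>j. p $ j) F = 0}"

definition ideal2 :: "nat \<Rightarrow> (nat, 'a::comm_ring_1) mpoly \<Rightarrow> (nat, 'a) mpoly \<Rightarrow> (nat, 'a) mpoly set" where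
  "ideal2 n g h = {P * g + R * h | P R. P \<in> polys n \<and> R \<in> polys n}"

text \<open>The rows of the invertible matrix \<open>A\<close> are the new coordinates, written as linear forms in
  the given ones, so a point \<open>p\<close> has new coordinates \<open>A p\<close>; \<open>W i\<close> is the affine cone over
  the \<open>i\<close>-th subspace. Only the values \<open>a i j\<close> with
  \<open>i, j \<le> n\<close> and \<open>i \<noteq> j\<close> matter, here and below.\<close>

definition adapted_coordinates ::
  "nat \<Rightarrow> (nat \<Rightarrow> 'a::comm_ring_1 vec set) \<Rightarrow> 'a mat \<Rightarrow> (nat \<Rightarrow> nat \<Rightarrow> 'a) \<Rightarrow> bool" where
  "adapted_coordinates n W A a \<longleftrightarrow>
     A \<in> carrier_mat (Suc n) (Suc n) \<and> invertible_mat A \<and>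
     (\<forall>i\<le>n. \<forall>j\<le>n. i \<noteq> j \<longrightarrow> a i j \<noteq> 0) \<and>
     (\<forall>i\<le>n. vanishing_ideal n ((\<lambda>p. A *\<^sub>v p) ` W i) = ideal2 n (Var i) (lin_f n a i))"


section \<open>The maps v and u\<close>

definition B_mat :: "nat \<Rightarrow> (nat \<Rightarrow> nat \<Rightarrow> 'a::comm_ring_1) \<Rightarrow> (nat, 'a) mpoly mat" where
  "B_mat n a = mat (Suc n) (Suc n)
     (\<lambda>(i, j). if i = j then - lin_f n a i else Const (a i j) * Var j)"

text \<open>If all \<open>a i j\<close> with \<open>i \<noteq> j\<close> are nonzero, the two definite descriptions below are well
  defined: since the rows of \<open>B\<close> sum to \<open>0\<close>, the columns of the \<open>i\<close>-th minor sum to a multiple of \<open>x\<^sub>i\<close>,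
  and the forms \<open>x\<^sub>i Q\<^sub>i\<close> are linearly independent because only the \<open>i\<close>-th one contains \<open>x\<^sub>i\<^sup>n\<close>.\<close>

definition Q_form :: "nat \<Rightarrow> (nat \<Rightarrow> nat \<Rightarrow> 'a::comm_ring_1) \<Rightarrow> nat \<Rightarrow> (nat, 'a) mpoly" where
  "Q_form n a i = (THE q. det (mat_delete (B_mat n a) i i) = Var i * q)"

definition v_map :: "nat \<Rightarrow> (nat \<Rightarrow> nat \<Rightarrow> 'a::comm_ring_1) \<Rightarrow> nat \<Rightarrow> (nat, 'a) mpoly" where
  "v_map n a i = Var i * Q_form n a i"

definition b_mat :: "nat \<Rightarrow> (nat \<Rightarrow> nat \<Rightarrow> 'a::comm_ring_1) \<Rightarrow> 'a mat" where
  "b_mat n a = (THE b. b \<in> carrier_mat (Suc n) (Suc n) \<and>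
     (\<forall>i\<le>n. lin_f n a i * Q_form n a i = (\<Sum>j\<le>n. Const (b $$ (i, j)) * (Var j * Q_form n a j))))"

text \<open>In the following definitions \<^term>\<open>Var j\<close> plays the role of the coordinate \<open>y\<^sub>j\<close>.\<close>

definition lin_g :: "nat \<Rightarrow> (nat \<Rightarrow> nat \<Rightarrow> 'a::comm_ring_1) \<Rightarrow> nat \<Rightarrow> (nat, 'a) mpoly" where
  "lin_g n a i = (\<Sum>j\<le>n. Const (b_mat n a $$ (i, j)) * Var j)"

definition C_mat :: "nat \<Rightarrow> (nat \<Rightarrow> nat \<Rightarrow> 'a::comm_ring_1) \<Rightarrow> (nat, 'a) mpoly mat" where
  "C_mat n a = mat (Suc n) (Suc n)
     (\<lambda>(i, j). if i = j then - lin_g n a i else Const (a i j) * Var j)"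

definition lambda_hom ::
  "nat \<Rightarrow> (nat \<Rightarrow> nat \<Rightarrow> 'a::comm_ring_1) \<Rightarrow> (nat, 'a) mpoly \<Rightarrow> (nat, 'a) mpoly" where
  "lambda_hom n a = poly_subst (\<lambda>i. det (mat_delete (C_mat n a) i i))"

definition u_map :: "nat \<Rightarrow> (nat \<Rightarrow> nat \<Rightarrow> 'a::comm_ring_1) \<Rightarrow> nat \<Rightarrow> (nat, 'a) mpoly" where
  "u_map n a = map_of_hom (lambda_hom n a)"

lemma u_map_eq_det: "u_map n a i = det (mat_delete (C_mat n a) i i)"
  by (simp add: u_map_def map_of_hom_def lambda_hom_def poly_subst_Var)

end

theory Submission
  imports Defs "HOL-Library.Product_Lexorder"
begin

text \<open>The inverse is explained by a duality between \<open>a\<close> and its transpose. The rows of \<open>B\<close> sum to zero,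
  so all cofactors of \<open>B\<close> in row \<open>i\<close> equal the diagonal minor \<open>det B\<^sub>i = x\<^sub>i Q\<^sub>i\<close>, and the vector \<open>y\<close>
  of these minors satisfies \<open>y B = 0\<close>. Written out, this is
  \<open>f\<^sub>j(x) y\<^sub>j = x\<^sub>j \<Sum>\<^sub>i a\<^sub>i\<^sub>j y\<^sub>i\<close>, the sum
  over \<open>i \<noteq> j\<close>. Dividing by \<open>x\<^sub>j\<close> shows that \<open>b\<close> is the transpose of \<open>a\<close>, i.e. the sum
  is \<open>g\<^sub>j(y)\<close> (\<open>b_mat_eq\<close>). Conjugation by the diagonal matrix of the coordinates then
  identifies \<open>det C\<^sub>i\<close> with the \<open>i\<close>-th minor of the matrix \<open>B\<close> built from the transpose of \<open>a\<close>
  (\<open>u_map_eq_v_minor\<close>): the map \<open>u\<close> for \<open>a\<close> is the map \<open>v\<close> for the transpose, and conversely.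

  For fixed \<open>y = v(x)\<close> the same relations \<open>f\<^sub>j(x) y\<^sub>j = x\<^sub>j g\<^sub>j(y)\<close> are linear equations for \<open>x\<close>. Their
  matrix is the transpose of the matrix \<open>B\<close> built from the transpose of \<open>a\<close>, in the
  variables \<open>y\<close>, whose diagonal minors are the components of \<open>u(y)\<close>; its kernel vector \<open>x\<close> is therefore
  proportional to \<open>u(y)\<close>, as an identity of polynomials (\<open>v_minor_comp_proportional\<close>). The composite
  does not vanish identically since \<open>u\<close> and \<open>v\<close> fix the coordinate points: at \<open>e\<^sub>i\<close> the matrix \<open>B\<^sub>i\<close> is
  diagonal with the nonzero entries \<open>- a\<^sub>k\<^sub>i\<close> (\<open>poly_eval_v_minor_axis\<close>). By the duality this also settles the other
  composite. So \<open>u\<close> and \<open>v\<close> are inverse to each other as soon as all \<open>a\<^sub>i\<^sub>j\<close> with \<open>i \<noteq> j\<close> are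
  nonzero, whatever adapted coordinates are chosen.

  The open set therefore consists of the tuples that have a frame whose first forms \<open>l\<^sub>i\<close> are
  coordinates and whose second forms have nonzero coefficients at all \<open>l\<^sub>j\<close> with \<open>j \<noteq> i\<close>. Multiplied by
  the determinant of the first forms these coefficients are polynomial in the frame, and the product
  of all of them with the determinant is the discriminant \<open>frame_discr\<close>. Two frames of one
  tuple differ by 2 by 2 matrices over the field, one for each index, so the set is described on
  frames by the nonvanishing of one of the discriminants of the changed frames, hence it is open. It is dense because polynomials
  over a field of characteristic 0 form a domain and are determined by their values
  (\<open>poly_eval_eq_0_imp\<close>). The latter fact also shows that the ideal of a subspace of
  codimension 2 is generated by two linear forms (\<open>vanishing_ideal_subspace\<close>).\<close>

section \<open>Cofactors of singular matrices\<close>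

lemma cofactor_transpose:
  assumes "N \<in> carrier_mat m m" "i < m" "j < m"
  shows "cofactor N\<^sup>T i j = cofactor N j i"
proof -
  have "mat_delete N\<^sup>T i j = (mat_delete N j i)\<^sup>T"
    using assms by (intro eq_matI) (auto simp: mat_delete_def)
  moreover have "mat_delete N j i \<in> carrier_mat (m - 1) (m - 1)"
    using assms(1) by (rule mat_delete_carrier)
  ultimately show ?thesis
    by (simp add: cofactor_def det_transpose add.commute)
qed

lemma cofactor_diag: "cofactor N i i = det (mat_delete N i i)"
  by (simp add: cofactor_def flip: mult_2)

text \<open>Replacing row \<open>r\<close> by the unit vector \<open>e\<^sub>k\<close> turns \<open>N x = 0\<close> into \<open>N' x = x\<^sub>k e\<^sub>r\<close>. Multiplying by the
  adjugate of \<open>N'\<close>, whose column \<open>r\<close> still consists of the cofactors of \<open>N\<close>, gives the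
  claim, a form of Cramer's rule.\<close>

lemma cofactor_row_kernel:
  fixes N :: "'a::comm_ring_1 mat"
  assumes N: "N \<in> carrier_mat m m" and r: "r < m" and k: "k < m" and j: "j < m"
    and ker: "\<And>s. s < m \<Longrightarrow> (\<Sum>t<m. N $$ (s, t) * x t) = 0"
  shows "x j * cofactor N r k = x k * cofactor N r j"
proof -
  define N' where
    "N' = mat m m (\<lambda>(s, t). if s = r then (if t = k then 1 else 0) else N $$ (s, t))"
  have N': "N' \<in> carrier_mat m m" by (simp add: N'_def)
  have cof: "cofactor N' r t = cofactor N r t" if "t < m" for t
  proof -
    have "mat_delete N' r t = mat_delete N r t"
      using N r that by (intro eq_matI) (auto simp: mat_delete_def N'_def)
    then show ?thesis by (simp add: cofactor_def)
  qed
  have "det N' = (\<Sum>t<m. (if t = k then 1 else 0) * cofactor N' r t)"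
    using laplace_expansion_row[OF N' r] r by (simp add: N'_def)
  also have "\<dots> = cofactor N r k"
    using k by (simp add: if_distrib[of "\<lambda>u. u * _"] cof cong: if_cong)
  finally have det: "det N' = cofactor N r k" .
  have row: "(\<Sum>t<m. N' $$ (s, t) * x t) = (if s = r then x k else 0)" if "s < m" for s
    using ker[OF that] that k by (simp add: N'_def if_distrib[of "\<lambda>u. u * _"] cong: if_cong)
  have entry: "(\<Sum>s<m. cofactor N' s j * N' $$ (s, t)) = (if j = t then det N' else 0)"
    if t: "t < m" for t
  proof -
    have "(adj_mat N' * N') $$ (j, t) = (\<Sum>s<m. cofactor N' s j * N' $$ (s, t))"
      using N' j t by (simp add: adj_mat_def scalar_prod_def lessThan_atLeast0)
    then show ?thesis
      using adj_mat(3)[OF N'] j t by (cases "j = t") simp_all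
  qed
  have "det N' * x j = (\<Sum>t<m. (if j = t then det N' else 0) * x t)"
    using j by (simp add: if_distrib[of "\<lambda>u. u * _"] cong: if_cong)
  also have "\<dots> = (\<Sum>t<m. \<Sum>s<m. cofactor N' s j * N' $$ (s, t) * x t)"
    by (intro sum.cong) (simp_all add: entry[symmetric] sum_distrib_right)
  also have "\<dots> = (\<Sum>s<m. cofactor N' s j * (\<Sum>t<m. N' $$ (s, t) * x t))"
    by (subst sum.swap) (simp add: sum_distrib_left mult.assoc)
  also have "\<dots> = (\<Sum>s<m. cofactor N' s j * (if s = r then x k else 0))"
    by (intro sum.cong) (simp_all add: row)
  also have "\<dots> = cofactor N r j * x k"
    using r j by (simp add: if_distrib[of "\<lambda>u. _ * u"] cof cong: if_cong)
  finally show ?thesis by (simp add: det mult.commute)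
qed

text \<open>The preceding rule for the kernel vector \<open>(1, \<dots>, 1)\<close>.\<close>

lemma cofactor_zero_row_sums:
  fixes N :: "'a::comm_ring_1 mat"
  assumes "N \<in> carrier_mat m m" "r < m" "k < m"
    and "\<And>s. s < m \<Longrightarrow> (\<Sum>t<m. N $$ (s, t)) = 0"
  shows "cofactor N r k = det (mat_delete N r r)"
  using cofactor_row_kernel[OF assms(1,2,3,2), of "\<lambda>_. 1"] assms(4)
  by (simp add: cofactor_diag)

text \<open>Since cofactors are constant along rows, every row of the adjugate is the vector of diagonal
  minors; the adjugate times \<open>N\<close> is \<open>det N\<close> times the identity, and \<open>det N = 0\<close>.\<close>

lemma diag_minors_left_kernel:
  fixes N :: "'a::comm_ring_1 mat"
  assumes N: "N \<in> carrier_mat m m" and s: "s < m"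
    and rows: "\<And>s. s < m \<Longrightarrow> (\<Sum>t<m. N $$ (s, t)) = 0"
  shows "(\<Sum>r<m. det (mat_delete N r r) * N $$ (r, s)) = 0"
proof -
  have entry: "(\<Sum>r<m. det (mat_delete N r r) * N $$ (r, t)) = (if s = t then det N else 0)"
    if t: "t < m" for t
  proof -
    have cof: "(\<Sum>r<m. cofactor N r s * N $$ (r, t)) =
        (\<Sum>r<m. det (mat_delete N r r) * N $$ (r, t))"
      using cofactor_zero_row_sums[OF N _ s rows] by simp
    have "(adj_mat N * N) $$ (s, t) = (\<Sum>r<m. cofactor N r s * N $$ (r, t))"
      using N s t by (simp add: adj_mat_def scalar_prod_def lessThan_atLeast0)
    with cof have "(adj_mat N * N) $$ (s, t) = (\<Sum>r<m. det (mat_delete N r r) * N $$ (r, t))"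
      by simp
    then show ?thesis
      using adj_mat(3)[OF N] s t by (cases "s = t") simp_all
  qed
  have "det N = (\<Sum>t<m. if s = t then det N else 0)"
    using s by simp
  also have "\<dots> = (\<Sum>t<m. \<Sum>r<m. det (mat_delete N r r) * N $$ (r, t))"
    by (intro sum.cong) (simp_all add: entry)
  also have "\<dots> = (\<Sum>r<m. det (mat_delete N r r) * (\<Sum>t<m. N $$ (r, t)))"
    by (subst sum.swap) (simp add: sum_distrib_left)
  also have "\<dots> = 0"
    by (simp add: rows)
  finally show ?thesis
    using entry[OF s] by simp
qed

text \<open>The vector \<open>(1, \<dots>, 1)\<close> in the right kernel makes all cofactors in one row agree with the
  diagonal minor. For the transposed matrix the same rule then compares the diagonal minors with a
  vector \<open>x\<close> in the left kernel.\<close>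

lemma diag_minors_proportional:
  fixes N :: "'a::comm_ring_1 mat"
  assumes N: "N \<in> carrier_mat m m" and j: "j < m" and k: "k < m"
    and rows: "\<And>s. s < m \<Longrightarrow> (\<Sum>t<m. N $$ (s, t)) = 0"
    and left: "\<And>t. t < m \<Longrightarrow> (\<Sum>s<m. x s * N $$ (s, t)) = 0"
  shows "x j * det (mat_delete N k k) = x k * det (mat_delete N j j)"
proof -
  have NT: "N\<^sup>T \<in> carrier_mat m m" using N by simp
  have "(\<Sum>t<m. N\<^sup>T $$ (s, t) * x t) = 0" if "s < m" for s
    using left[OF that] N that by (simp add: mult.commute)
  from cofactor_row_kernel[OF NT k k j this]
  have "x j * cofactor N k k = x k * cofactor N j k"
    by (simp add: cofactor_transpose[OF N] j k)
  then show ?thesis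
    by (simp add: cofactor_zero_row_sums[OF N _ k rows] j k)
qed

lemma dvd_det_column:
  fixes A :: "'a::comm_ring_1 mat"
  assumes "A \<in> carrier_mat m m" "c < m" "\<And>r. r < m \<Longrightarrow> d dvd A $$ (r, c)"
  shows "d dvd det A"
  by (subst laplace_expansion_column[OF assms(1,2)]) (auto intro!: dvd_sum assms(3) dvd_mult2)


section \<open>Evaluation of polynomials\<close>

definition monom_eval :: "('x \<Rightarrow> 'b::comm_ring_1) \<Rightarrow> ('x \<Rightarrow>\<^sub>0 nat) \<Rightarrow> 'b" where
  "monom_eval \<sigma> m = (\<Prod>i\<in>Poly_Mapping.keys m. \<sigma> i ^ Poly_Mapping.lookup m i)"

text \<open>Evaluation at scalars and substitution of polynomials are the two instances of this map
  that matter, so that their homomorphism property is proved only once.\<close>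

definition mpoly_eval ::
  "('a \<Rightarrow> 'b) \<Rightarrow> ('x \<Rightarrow> 'b::comm_ring_1) \<Rightarrow> ('x, 'a::comm_ring_1) mpoly \<Rightarrow> 'b" where
  "mpoly_eval \<phi> \<sigma> F =
     (\<Sum>m\<in>Poly_Mapping.keys F. \<phi> (Poly_Mapping.lookup F m) * monom_eval \<sigma> m)"

lemma monom_eval_superset:
  assumes "finite A" "Poly_Mapping.keys m \<subseteq> A"
  shows "monom_eval \<sigma> m = (\<Prod>i\<in>A. \<sigma> i ^ Poly_Mapping.lookup m i)"
  unfolding monom_eval_def using assms
  by (intro prod.mono_neutral_left) (auto simp: in_keys_iff)

lemma monom_eval_0 [simp]: "monom_eval \<sigma> 0 = 1"
  by (simp add: monom_eval_def)

lemma monom_eval_add: "monom_eval \<sigma> (m + m') = monom_eval \<sigma> m * monom_eval \<sigma> m'"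
proof -
  let ?A = "Poly_Mapping.keys m \<union> Poly_Mapping.keys m'"
  have "finite ?A" by simp
  note sup = monom_eval_superset[OF this]
  show ?thesis
    using Poly_Mapping.keys_add[of m m']
    by (simp add: sup lookup_add power_add prod.distrib)
qed

lemma poly_mapping_sum_single:
  "F = (\<Sum>m\<in>Poly_Mapping.keys F. Poly_Mapping.single m (Poly_Mapping.lookup F m))"
  by (rule poly_mapping_eqI) (auto simp: lookup_sum lookup_single when_def in_keys_iff)

context comm_ring_hom
begin

lemma mpoly_eval_superset:
  assumes "finite A" "Poly_Mapping.keys F \<subseteq> A"
  shows "mpoly_eval hom \<sigma> F = (\<Sum>m\<in>A. hom (Poly_Mapping.lookup F m) * monom_eval \<sigma> m)"
  unfolding mpoly_eval_def using assms
  by (intro sum.mono_neutral_left) (auto simp: in_keys_iff)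

lemma mpoly_eval_add: "mpoly_eval hom \<sigma> (F + G) = mpoly_eval hom \<sigma> F + mpoly_eval hom \<sigma> G"
proof -
  let ?A = "Poly_Mapping.keys F \<union> Poly_Mapping.keys G"
  have "finite ?A" by simp
  note sup = mpoly_eval_superset[OF this]
  show ?thesis
    using Poly_Mapping.keys_add[of F G]
    by (simp add: sup lookup_add hom_distribs distrib_right sum.distrib)
qed

lemma mpoly_eval_sum: "mpoly_eval hom \<sigma> (\<Sum>i\<in>A. F i) = (\<Sum>i\<in>A. mpoly_eval hom \<sigma> (F i))"
  by (induction A rule: infinite_finite_induct)
    (simp_all add: mpoly_eval_add, simp_all add: mpoly_eval_def)

lemma mpoly_eval_single: "mpoly_eval hom \<sigma> (Poly_Mapping.single m c) = hom c * monom_eval \<sigma> m"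
  by (simp add: mpoly_eval_def)

lemma mpoly_eval_mult: "mpoly_eval hom \<sigma> (F * G) = mpoly_eval hom \<sigma> F * mpoly_eval hom \<sigma> G"
proof -
  let ?s = "\<lambda>H m. Poly_Mapping.single m (Poly_Mapping.lookup H m)"
  have single: "mpoly_eval hom \<sigma> (?s F m * ?s G m') =
      (hom (Poly_Mapping.lookup F m) * monom_eval \<sigma> m) *
      (hom (Poly_Mapping.lookup G m') * monom_eval \<sigma> m')" for m m'
    by (simp add: mult_single mpoly_eval_single monom_eval_add hom_mult)
  have "F * G = (\<Sum>m\<in>Poly_Mapping.keys F. ?s F m) * (\<Sum>m\<in>Poly_Mapping.keys G. ?s G m)"
    by (simp flip: poly_mapping_sum_single)
  also have "\<dots> = (\<Sum>m\<in>Poly_Mapping.keys F. \<Sum>m'\<in>Poly_Mapping.keys G. ?s F m * ?s G m')"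
    by (rule sum_product)
  finally show ?thesis
    by (simp only: mpoly_eval_sum single) (simp only: mpoly_eval_def sum_product)
qed

lemma mpoly_eval_zero: "mpoly_eval hom \<sigma> 0 = 0"
  by (simp add: mpoly_eval_def)

lemma mpoly_eval_one: "mpoly_eval hom \<sigma> 1 = 1"
  using mpoly_eval_single[of \<sigma> 0 1] by simp

end

lemma comm_ring_hom_mpoly_eval:
  assumes "comm_ring_hom \<phi>"
  shows "comm_ring_hom (mpoly_eval \<phi> \<sigma>)"
  by unfold_locales (simp_all only: comm_ring_hom.mpoly_eval_add[OF assms]
      comm_ring_hom.mpoly_eval_mult[OF assms] comm_ring_hom.mpoly_eval_zero[OF assms]
      comm_ring_hom.mpoly_eval_one[OF assms])

lemma comm_ring_hom_Const: "comm_ring_hom (Const :: 'a::comm_ring_1 \<Rightarrow> ('x, 'a) mpoly)"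
  by unfold_locales (simp_all add: Const_def single_add mult_single)

lemma poly_eval_conv: "poly_eval \<sigma> = mpoly_eval id \<sigma>"
  by (simp add: poly_eval_def mpoly_eval_def monom_eval_def fun_eq_iff)

lemma poly_subst_conv: "poly_subst \<sigma> = mpoly_eval Const \<sigma>"
  by (simp add: poly_subst_def mpoly_eval_def monom_eval_def fun_eq_iff)

lemma comm_ring_hom_id: "comm_ring_hom (id :: 'a::comm_ring_1 \<Rightarrow> 'a)"
  by unfold_locales simp_all

interpretation poly_eval: comm_ring_hom "poly_eval \<sigma> :: ('x, 'a::comm_ring_1) mpoly \<Rightarrow> 'a" for \<sigma>
  unfolding poly_eval_conv by (rule comm_ring_hom_mpoly_eval[OF comm_ring_hom_id])

interpretation poly_subst: comm_ring_hom
  "poly_subst \<sigma> :: ('x, 'a::comm_ring_1) mpoly \<Rightarrow> ('y, 'a) mpoly" for \<sigma>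
  unfolding poly_subst_conv by (rule comm_ring_hom_mpoly_eval[OF comm_ring_hom_Const])

lemma poly_eval_Const [simp]: "poly_eval \<sigma> (Const c) = c"
  by (simp add: poly_eval_def Const_def)

lemma poly_eval_Var [simp]: "poly_eval \<sigma> (Var i) = \<sigma> i"
  by (simp add: poly_eval_def Var_def)

lemma poly_subst_Const [simp]: "poly_subst \<sigma> (Const c) = Const c"
  by (simp add: poly_subst_def Const_def)

declare poly_subst_Var [simp]

lemma poly_eval_subst: "poly_eval p (poly_subst G F) = poly_eval (\<lambda>i. poly_eval p (G i)) F"
  unfolding poly_subst_def poly_eval_def[of _ F]
  by (simp only: poly_eval.hom_sum poly_eval.hom_mult poly_eval.hom_prod poly_eval.hom_power
      poly_eval_Const)

lemma Var_nonzero [simp]: "Var i \<noteq> (0 :: ('x, 'a::comm_ring_1) mpoly)"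
proof
  assume "Var i = (0 :: ('x, 'a) mpoly)"
  then have "poly_eval (\<lambda>_. 1 :: 'a) (Var i) = 0"
    by (simp only: poly_eval.hom_zero)
  then show False by simp
qed

section \<open>The diagonal minors of B\<close>

definition v_minor :: "nat \<Rightarrow> (nat \<Rightarrow> nat \<Rightarrow> 'a::comm_ring_1) \<Rightarrow> nat \<Rightarrow> (nat, 'a) mpoly" where
  "v_minor n a i = det (mat_delete (B_mat n a) i i)"

abbreviation (input) flip_coeffs :: "(nat \<Rightarrow> nat \<Rightarrow> 'a) \<Rightarrow> nat \<Rightarrow> nat \<Rightarrow> 'a" where
  "flip_coeffs a \<equiv> \<lambda>i j. a j i"

definition offdiag_nonzero :: "nat \<Rightarrow> (nat \<Rightarrow> nat \<Rightarrow> 'a::zero) \<Rightarrow> bool" where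
  "offdiag_nonzero n a \<longleftrightarrow> (\<forall>i\<le>n. \<forall>j\<le>n. i \<noteq> j \<longrightarrow> a i j \<noteq> 0)"

lemma offdiag_nonzero_flip: "offdiag_nonzero n a \<Longrightarrow> offdiag_nonzero n (flip_coeffs a)"
  unfolding offdiag_nonzero_def by metis

lemma B_mat_carrier: "B_mat n a \<in> carrier_mat (Suc n) (Suc n)"
  by (simp add: B_mat_def)

lemma sum_lessThan_Suc_remove:
  "s \<le> n \<Longrightarrow> (\<Sum>t<Suc n. h t) = h s + (\<Sum>t\<in>{..n} - {s}. h t)" for h :: "nat \<Rightarrow> 'b::comm_monoid_add"
  by (simp add: lessThan_Suc_atMost sum.remove)

lemma B_mat_row_sum:
  assumes "s < Suc n"
  shows "(\<Sum>t<Suc n. B_mat n a $$ (s, t)) = 0"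
proof -
  have "(\<Sum>t\<in>{..n} - {s}. B_mat n a $$ (s, t)) = lin_f n a s"
    unfolding lin_f_def using assms by (intro sum.cong) (auto simp: B_mat_def)
  then show ?thesis
    using assms by (subst sum_lessThan_Suc_remove[of s]) (simp_all add: B_mat_def)
qed

text \<open>The \<open>i\<close>-th diagonal minor equals the cofactor at any \<open>(i, j)\<close>. For \<open>j \<noteq> i\<close> the latter still
  involves column \<open>i\<close>, which below and above its diagonal entry consists of multiples of \<open>x\<^sub>i\<close>.\<close>

lemma Var_dvd_v_minor:
  assumes n: "n \<ge> 1" and i: "i \<le> n"
  shows "Var i dvd v_minor n a i"
proof -
  define j where "j = (if i = 0 then 1 else 0 :: nat)"
  have j: "j \<le> n" "j \<noteq> i" using n by (auto simp: j_def)
  define c where "c = (if i < j then i else i - 1)"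
  have c: "c < n" using i j by (auto simp: c_def)
  have M: "mat_delete (B_mat n a) i j \<in> carrier_mat n n"
    using mat_delete_carrier[OF B_mat_carrier, of n a] by simp
  have "Var i dvd mat_delete (B_mat n a) i j $$ (r, c)" if r: "r < n" for r
    using i j c r by (auto simp: mat_delete_def B_mat_def c_def)
  then have "Var i dvd det (mat_delete (B_mat n a) i j)"
    using dvd_det_column[OF M c] by blast
  then have "Var i dvd cofactor (B_mat n a) i j"
    by (simp add: cofactor_def)
  also have "cofactor (B_mat n a) i j = v_minor n a i"
    unfolding v_minor_def
    by (rule cofactor_zero_row_sums[OF B_mat_carrier _ _ B_mat_row_sum]) (use i j in auto)
  finally show ?thesis .
qed

lemma v_minor_eq_Q_form:
  fixes a :: "nat \<Rightarrow> nat \<Rightarrow> 'a::idom"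
  assumes "n \<ge> 1" "i \<le> n"
  shows "v_minor n a i = Var i * Q_form n a i"
proof -
  from Var_dvd_v_minor[OF assms, of a] obtain q where q: "v_minor n a i = Var i * q" ..
  have "det (mat_delete (B_mat n a) i i) = Var i * Q_form n a i"
    unfolding Q_form_def
  proof (rule theI)
    show "det (mat_delete (B_mat n a) i i) = Var i * q"
      using q by (simp add: v_minor_def)
    fix q' assume "det (mat_delete (B_mat n a) i i) = Var i * q'"
    then show "q' = q" using q by (simp add: v_minor_def)
  qed
  then show ?thesis by (simp add: v_minor_def)
qed

lemma v_map_eq_v_minor:
  fixes a :: "nat \<Rightarrow> nat \<Rightarrow> 'a::idom"
  shows "n \<ge> 1 \<Longrightarrow> i \<le> n \<Longrightarrow> v_map n a i = v_minor n a i"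
  by (simp add: v_map_def v_minor_eq_Q_form)

text \<open>The relation \<open>f\<^sub>s(x) y\<^sub>s = x\<^sub>s g\<^sub>s(y)\<close> between \<open>x\<close> and \<open>y = v(x)\<close>: it is column \<open>s\<close> of \<open>y B = 0\<close>.\<close>

lemma v_minor_relation:
  assumes s: "s \<le> n"
  shows "lin_f n a s * v_minor n a s = Var s * (\<Sum>r\<in>{..n} - {s}. Const (a r s) * v_minor n a r)"
proof -
  have "0 = (\<Sum>r<Suc n. v_minor n a r * B_mat n a $$ (r, s))"
    using diag_minors_left_kernel[OF B_mat_carrier _ B_mat_row_sum, of s n a] s
    by (simp add: v_minor_def)
  also have "\<dots> = - (v_minor n a s * lin_f n a s) +
      (\<Sum>r\<in>{..n} - {s}. v_minor n a r * B_mat n a $$ (r, s))"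
    using s by (subst sum_lessThan_Suc_remove[OF s]) (simp add: B_mat_def)
  also have "(\<Sum>r\<in>{..n} - {s}. v_minor n a r * B_mat n a $$ (r, s)) =
      Var s * (\<Sum>r\<in>{..n} - {s}. Const (a r s) * v_minor n a r)"
    unfolding sum_distrib_left using s by (intro sum.cong) (auto simp: B_mat_def mult_ac)
  finally show ?thesis by (simp add: mult.commute)
qed

lemma lin_f_Q_form:
  fixes a :: "nat \<Rightarrow> nat \<Rightarrow> 'a::idom"
  assumes n: "n \<ge> 1" and s: "s \<le> n"
  shows "lin_f n a s * Q_form n a s = (\<Sum>r\<in>{..n} - {s}. Const (a r s) * (Var r * Q_form n a r))"
proof -
  have "(\<Sum>r\<in>{..n} - {s}. Const (a r s) * (Var r * Q_form n a r)) =
      (\<Sum>r\<in>{..n} - {s}. Const (a r s) * v_minor n a r)"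
    by (intro sum.cong) (use n in \<open>auto simp: v_minor_eq_Q_form\<close>)
  moreover have "Var s * (lin_f n a s * Q_form n a s) =
      Var s * (\<Sum>r\<in>{..n} - {s}. Const (a r s) * v_minor n a r)"
    using v_minor_relation[OF s, of a] by (simp add: v_minor_eq_Q_form[OF n s] mult_ac)
  ultimately show ?thesis by simp
qed

text \<open>At a point of the \<open>i\<close>-th coordinate axis the matrix \<open>B\<^sub>i\<close> is diagonal with entries
  \<open>- a\<^sub>k\<^sub>i x\<^sub>i\<close>, and the other minors vanish. So the map \<open>v\<close> fixes the coordinate points.\<close>

lemma poly_eval_v_minor_axis:
  fixes a :: "nat \<Rightarrow> nat \<Rightarrow> 'a::idom"
  assumes a: "offdiag_nonzero n a" and i: "i \<le> n" and \<sigma>: "\<sigma> i \<noteq> 0"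
    and axis: "\<And>j. j \<le> n \<Longrightarrow> j \<noteq> i \<Longrightarrow> \<sigma> j = 0"
  shows "poly_eval \<sigma> (v_minor n a i) \<noteq> 0"
proof -
  have lin: "poly_eval \<sigma> (lin_f n a k) = a k i * \<sigma> i" if "k \<le> n" "k \<noteq> i" for k
  proof -
    have "poly_eval \<sigma> (lin_f n a k) = (\<Sum>j\<in>{..n} - {k}. a k j * \<sigma> j)"
      by (simp add: lin_f_def poly_eval.hom_sum poly_eval.hom_mult)
    also have "\<dots> = (\<Sum>j\<in>{i}. a k j * \<sigma> j)"
      using that i by (intro sum.mono_neutral_right) (auto simp: axis)
    finally show ?thesis by simp
  qed
  let ?M = "map_mat (poly_eval \<sigma>) (mat_delete (B_mat n a) i i)"
  have M: "?M \<in> carrier_mat n n"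
    using mat_delete_carrier[OF B_mat_carrier, of n a] by simp
  have entries: "?M $$ (r, s) = (if r = s then - (a (if r < i then r else Suc r) i * \<sigma> i) else 0)"
    if "r < n" "s < n" for r s
    using that i
    by (auto simp: mat_delete_def B_mat_def lin axis poly_eval.hom_uminus poly_eval.hom_mult)
  have "det ?M = prod_list (diag_mat ?M)"
    using M by (intro det_upper_triangular[of _ n]) (auto simp: upper_triangular_def entries)
  moreover have "0 \<notin> set (diag_mat ?M)"
  proof
    assume "0 \<in> set (diag_mat ?M)"
    then obtain r where r: "r < n" "?M $$ (r, r) = 0"
      using M by (auto simp: diag_mat_def)
    have "a (if r < i then r else Suc r) i \<noteq> 0"
      using a r(1) i by (auto simp: offdiag_nonzero_def)
    then show False using r \<sigma> entries[of r r] by auto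
  qed
  ultimately show ?thesis
    by (simp add: v_minor_def prod_list_zero_iff)
qed

lemma poly_eval_v_minor_axis_other:
  assumes "n \<ge> 1" "j \<le> n" "\<sigma> j = 0"
  shows "poly_eval \<sigma> (v_minor n a j) = 0"
proof -
  from Var_dvd_v_minor[OF assms(1,2), of a] obtain q where "v_minor n a j = Var j * q" ..
  then show ?thesis using assms(3) by (simp add: poly_eval.hom_mult)
qed

text \<open>The matrix \<open>b\<close> is the transpose of \<open>a\<close> with zero diagonal: the relation between \<open>x\<close> and \<open>v(x)\<close>,
  divided by \<open>x\<^sub>i\<close>, already has the form that defines \<open>b\<close>.\<close>

lemma b_mat_eq:
  fixes a :: "nat \<Rightarrow> nat \<Rightarrow> 'a::idom"
  assumes n: "n \<ge> 1" and a: "offdiag_nonzero n a"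
  shows "b_mat n a = mat (Suc n) (Suc n) (\<lambda>(i, j). if i = j then 0 else a j i)"
    (is "_ = ?b")
  unfolding b_mat_def
proof (rule the_equality)
  have b_rep: "lin_f n a i * Q_form n a i =
      (\<Sum>j\<le>n. Const (?b $$ (i, j)) * (Var j * Q_form n a j))" if i: "i \<le> n" for i
  proof -
    have "(\<Sum>j\<le>n. Const (?b $$ (i, j)) * (Var j * Q_form n a j)) =
        (\<Sum>j\<in>{..n} - {i}. Const (?b $$ (i, j)) * (Var j * Q_form n a j))"
      using i by (intro sum.mono_neutral_right) (auto simp: Const_def)
    also have "\<dots> = lin_f n a i * Q_form n a i"
      unfolding lin_f_Q_form[OF n i] using i by (intro sum.cong) auto
    finally show ?thesis by simp
  qed
  then show "?b \<in> carrier_mat (Suc n) (Suc n) \<and> (\<forall>i\<le>n. lin_f n a i * Q_form n a i =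
      (\<Sum>j\<le>n. Const (?b $$ (i, j)) * (Var j * Q_form n a j)))"
    by simp
  fix b assume b: "b \<in> carrier_mat (Suc n) (Suc n) \<and> (\<forall>i\<le>n. lin_f n a i * Q_form n a i =
      (\<Sum>j\<le>n. Const (b $$ (i, j)) * (Var j * Q_form n a j)))"
  show "b = ?b"
  proof (rule eq_matI)
    fix i k assume "i < dim_row ?b" "k < dim_col ?b"
    then have i: "i \<le> n" and k: "k \<le> n" by auto
    define \<sigma> :: "nat \<Rightarrow> 'a" where "\<sigma> = (\<lambda>j. if j = k then 1 else 0)"
    \<comment> \<open>Evaluating at the \<open>k\<close>-th unit vector extracts the \<open>k\<close>-th coefficient of a representation.\<close>
    have ev: "poly_eval \<sigma> (\<Sum>j\<le>n. Const (c j) * (Var j * Q_form n a j)) =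
        c k * poly_eval \<sigma> (v_minor n a k)" for c
    proof -
      have "poly_eval \<sigma> (\<Sum>j\<le>n. Const (c j) * (Var j * Q_form n a j)) =
          (\<Sum>j\<le>n. c j * poly_eval \<sigma> (v_minor n a j))"
        using n by (simp add: v_minor_eq_Q_form poly_eval.hom_sum poly_eval.hom_mult)
      also have "\<dots> = (\<Sum>j\<in>{k}. c j * poly_eval \<sigma> (v_minor n a j))"
        using k n by (intro sum.mono_neutral_right)
          (auto simp: poly_eval_v_minor_axis_other \<sigma>_def)
      finally show ?thesis by simp
    qed
    have "lin_f n a i * Q_form n a i = (\<Sum>j\<le>n. Const (b $$ (i, j)) * (Var j * Q_form n a j))"
      using b i by blast
    from arg_cong[OF trans[OF this[symmetric] b_rep[OF i]], of "poly_eval \<sigma>"]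
    have "b $$ (i, k) * poly_eval \<sigma> (v_minor n a k) = ?b $$ (i, k) * poly_eval \<sigma> (v_minor n a k)"
      unfolding ev .
    moreover have "poly_eval \<sigma> (v_minor n a k) \<noteq> 0"
      by (rule poly_eval_v_minor_axis[OF a k]) (auto simp: \<sigma>_def)
    ultimately show "b $$ (i, k) = ?b $$ (i, k)" by simp
  qed (use b in auto)
qed

lemma lin_g_eq:
  fixes a :: "nat \<Rightarrow> nat \<Rightarrow> 'a::idom"
  assumes n: "n \<ge> 1" and a: "offdiag_nonzero n a" and i: "i \<le> n"
  shows "lin_g n a i = lin_f n (flip_coeffs a) i"
proof -
  have "lin_g n a i = (\<Sum>j\<in>{..n} - {i}. Const (b_mat n a $$ (i, j)) * Var j)"
    unfolding lin_g_def using i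
    by (intro sum.mono_neutral_right) (auto simp: b_mat_eq[OF n a] Const_def)
  also have "\<dots> = lin_f n (flip_coeffs a) i"
    unfolding lin_f_def using i by (intro sum.cong) (auto simp: b_mat_eq[OF n a])
  finally show ?thesis .
qed

text \<open>Here \<open>C\<close> is built from \<open>a\<close> with scaled columns, while the matrix \<open>B\<close> for the flipped
  coefficients has, after transposition, scaled rows instead. Conjugation by the diagonal matrix
  of the coordinates takes one to the other and keeps the diagonal minors.\<close>

lemma u_map_eq_v_minor:
  fixes a :: "nat \<Rightarrow> nat \<Rightarrow> 'a::idom"
  assumes n: "n \<ge> 1" and a: "offdiag_nonzero n a"
  shows "u_map n a i = v_minor n (flip_coeffs a) i"
proof -
  define y where "y r = (Var (if r < i then r else Suc r) :: (nat, 'a) mpoly)" for r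
  let ?D = "mat_diag n y"
  let ?C = "mat_delete (C_mat n a) i i"
  let ?B = "mat_delete (B_mat n (flip_coeffs a)) i i"
  have C: "?C \<in> carrier_mat n n" and B: "?B\<^sup>T \<in> carrier_mat n n" and D: "?D \<in> carrier_mat n n"
    by (auto simp: C_mat_def B_mat_def mat_delete_def)
  have conj: "?D * ?C = ?B\<^sup>T * ?D"
    unfolding mat_diag_mult_left[OF C] mat_diag_mult_right[OF B]
    by (intro eq_matI)
      (auto simp: mat_delete_def C_mat_def B_mat_def y_def lin_g_eq[OF n a] mult_ac)
  have "det ?D = prod_list (diag_mat ?D)"
    by (intro det_upper_triangular[of _ n]) (auto simp: mat_diag_def upper_triangular_def)
  moreover have "0 \<notin> set (diag_mat ?D)"
    by (auto simp: diag_mat_def mat_diag_def y_def)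
  ultimately have nz: "det ?D \<noteq> 0"
    by (simp add: prod_list_zero_iff)
  have "?B \<in> carrier_mat n n" by (simp add: B_mat_def mat_delete_def)
  then have "det ?D * det ?C = det ?B * det ?D"
    using arg_cong[OF conj, of det] by (simp add: det_mult[OF D C] det_mult[OF B D] det_transpose)
  then have "det ?C = det ?B" using nz by (simp add: mult.commute)
  then show ?thesis by (simp add: u_map_eq_det v_minor_def)
qed

text \<open>Reading the relation between \<open>x\<close> and \<open>y = v(x)\<close> as a linear system for \<open>x\<close> gives a matrix in
  \<open>y\<close> that kills \<open>x\<close> and whose diagonal minors are the components of the candidate inverse.\<close>

lemma v_minor_comp_proportional:
  assumes j: "j \<le> n" and k: "k \<le> n"
  shows "Var j * poly_subst (v_minor n a) (v_minor n (flip_coeffs a) k) =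
    Var k * poly_subst (v_minor n a) (v_minor n (flip_coeffs a) j)"
proof -
  let ?h = "poly_subst (v_minor n a)"
  let ?B = "B_mat n (flip_coeffs a)"
  let ?N = "map_mat ?h ?B"
  have N: "?N \<in> carrier_mat (Suc n) (Suc n)"
    by (simp add: B_mat_def)
  have minor: "det (mat_delete ?N i i) = ?h (v_minor n (flip_coeffs a) i)" if "i \<le> n" for i
  proof -
    have "mat_delete ?N i i = map_mat ?h (mat_delete ?B i i)"
      using that by (intro eq_matI) (auto simp: mat_delete_def B_mat_def)
    then show ?thesis by (simp add: v_minor_def)
  qed
  have rows: "(\<Sum>t<Suc n. ?N $$ (s, t)) = 0" if s: "s < Suc n" for s
  proof -
    have "(\<Sum>t<Suc n. ?N $$ (s, t)) = ?h (\<Sum>t<Suc n. ?B $$ (s, t))"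
      unfolding poly_subst.hom_sum using s by (intro sum.cong) (auto simp: B_mat_def)
    then show ?thesis using B_mat_row_sum[OF s, of "flip_coeffs a"] by simp
  qed
  have left: "(\<Sum>s<Suc n. Var s * ?N $$ (s, t)) = 0" if "t < Suc n" for t
  proof -
    have t: "t \<le> n" using that by simp
    have "?h (lin_f n (flip_coeffs a) t) = (\<Sum>r\<in>{..n} - {t}. Const (a r t) * v_minor n a r)"
      by (simp add: lin_f_def poly_subst.hom_sum poly_subst.hom_mult)
    then have "Var t * ?N $$ (t, t) = - (lin_f n a t * v_minor n a t)"
      using t by (simp add: B_mat_def poly_subst.hom_uminus v_minor_relation)
    moreover have "(\<Sum>s\<in>{..n} - {t}. Var s * ?N $$ (s, t)) = lin_f n a t * v_minor n a t"
      unfolding lin_f_def sum_distrib_right using t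
      by (intro sum.cong) (auto simp: B_mat_def poly_subst.hom_mult mult_ac)
    ultimately show ?thesis
      by (subst sum_lessThan_Suc_remove[OF t]) simp
  qed
  show ?thesis
    using diag_minors_proportional[OF N _ _ rows left, of j k] j k by (simp add: minor)
qed

section \<open>Forms and rational maps\<close>

definition total_degree :: "('x \<Rightarrow>\<^sub>0 nat) \<Rightarrow> nat" where
  "total_degree m = (\<Sum>i\<in>Poly_Mapping.keys m. Poly_Mapping.lookup m i)"

lemma total_degree_add: "total_degree (m + m') = total_degree m + total_degree m'"
proof -
  let ?A = "Poly_Mapping.keys m \<union> Poly_Mapping.keys m'"
  have "total_degree k = (\<Sum>i\<in>?A. Poly_Mapping.lookup k i)"
    if "Poly_Mapping.keys k \<subseteq> ?A" for k
    unfolding total_degree_def using that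
    by (intro sum.mono_neutral_left) (auto simp: in_keys_iff)
  then show ?thesis
    using Poly_Mapping.keys_add[of m m'] by (simp add: lookup_add sum.distrib)
qed

lemma form_altdef:
  "form n d F \<longleftrightarrow> (\<forall>m\<in>Poly_Mapping.keys F. Poly_Mapping.keys m \<subseteq> {..n} \<and> total_degree m = d)"
  by (auto simp: form_def polys_def total_degree_def)

lemma form_0 [simp]: "form n d 0"
  by (simp add: form_altdef)

lemma form_Const: "form n 0 (Const c)"
  by (simp add: form_altdef Const_def total_degree_def)

lemma form_1: "form n 0 1"
  by (simp add: form_altdef total_degree_def)

lemma form_Var: "i \<le> n \<Longrightarrow> form n 1 (Var i)"
  by (simp add: form_altdef Var_def total_degree_def)

lemma form_add: "form n d F \<Longrightarrow> form n d G \<Longrightarrow> form n d (F + G)"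
  using Poly_Mapping.keys_add[of F G] unfolding form_altdef by blast

lemma form_uminus: "form n d F \<Longrightarrow> form n d (- F)"
  by (simp add: form_altdef)

lemma form_sum: "(\<And>i. i \<in> A \<Longrightarrow> form n d (F i)) \<Longrightarrow> form n d (\<Sum>i\<in>A. F i)"
  by (induction A rule: infinite_finite_induct) (auto intro: form_add)

lemma form_mult:
  assumes "form n d F" "form n e G"
  shows "form n (d + e) (F * G)"
  unfolding form_altdef
proof
  fix m assume "m \<in> Poly_Mapping.keys (F * G)"
  then obtain p q where "m = p + q" "p \<in> Poly_Mapping.keys F" "q \<in> Poly_Mapping.keys G"
    using keys_mult[of F G] by blast
  then show "Poly_Mapping.keys m \<subseteq> {..n} \<and> total_degree m = d + e"
    using assms Poly_Mapping.keys_add[of p q]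
    by (fastforce simp: form_altdef total_degree_add)
qed

lemma form_mult_Const: "form n d F \<Longrightarrow> form n d (Const c * F)"
  using form_mult[OF form_Const] by fastforce

lemma form_prod:
  "(\<And>i. i \<in> A \<Longrightarrow> form n (d i) (F i)) \<Longrightarrow> form n (\<Sum>i\<in>A. d i) (\<Prod>i\<in>A. F i)"
  by (induction A rule: infinite_finite_induct) (auto intro: form_mult form_1)

lemma form_power: "form n d F \<Longrightarrow> form n (d * k) (F ^ k)"
  by (induction k) (auto intro: form_mult form_1)

lemma form_det:
  assumes A: "A \<in> carrier_mat m m" and "\<And>i j. i < m \<Longrightarrow> j < m \<Longrightarrow> form n 1 (A $$ (i, j))"
  shows "form n m (det A)"
  unfolding det_def'[OF A]
proof (rule form_sum)
  fix p assume "p \<in> {p. p permutes {0..<m}}"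
  then have p: "p permutes {0..<m}" by simp
  have "form n (\<Sum>i = 0..<m. 1) (\<Prod>i = 0..<m. A $$ (i, p i))"
    by (rule form_prod) (use assms(2) permutes_in_image[OF p] in auto)
  then show "form n m (signof p * (\<Prod>i = 0..<m. A $$ (i, p i)))"
    by (auto simp: sign_def intro: form_uminus)
qed

lemma form_lin_f: "form n 1 (lin_f n a i)"
  unfolding lin_f_def by (intro form_sum form_mult_Const form_Var) auto

lemma form_v_minor: "i \<le> n \<Longrightarrow> form n n (v_minor n a i)"
  unfolding v_minor_def
proof (rule form_det)
  show "mat_delete (B_mat n a) i i \<in> carrier_mat n n"
    using mat_delete_carrier[OF B_mat_carrier, of n a] by simp
qed (auto simp: mat_delete_def B_mat_def simp del: One_nat_def
    intro!: form_uminus form_lin_f form_mult_Const form_Var)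

lemma form_poly_subst:
  assumes F: "form n d F" and G: "\<And>i. i \<le> n \<Longrightarrow> form n e (G i)"
  shows "form n (e * d) (poly_subst G F)"
  unfolding poly_subst_def
proof (intro form_sum form_mult_Const)
  fix m assume "m \<in> Poly_Mapping.keys F"
  then have m: "Poly_Mapping.keys m \<subseteq> {..n}" "total_degree m = d"
    using F by (auto simp: form_altdef)
  have "form n (\<Sum>i\<in>Poly_Mapping.keys m. e * Poly_Mapping.lookup m i)
      (\<Prod>i\<in>Poly_Mapping.keys m. G i ^ Poly_Mapping.lookup m i)"
    using m(1) by (intro form_prod form_power G) auto
  then show "form n (e * d) (\<Prod>i\<in>Poly_Mapping.keys m. G i ^ Poly_Mapping.lookup m i)"
    using m(2) by (simp add: total_degree_def flip: sum_distrib_left)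
qed

lemma poly_subst_cong:
  assumes "F \<in> polys n" "\<And>i. i \<le> n \<Longrightarrow> G i = H i"
  shows "poly_subst G F = poly_subst H F"
  unfolding poly_subst_def
proof (rule sum.cong)
  fix m assume "m \<in> Poly_Mapping.keys F"
  then have "Poly_Mapping.keys m \<subseteq> {..n}" using assms(1) by (auto simp: polys_def)
  then have "(\<Prod>i\<in>Poly_Mapping.keys m. G i ^ Poly_Mapping.lookup m i) =
      (\<Prod>i\<in>Poly_Mapping.keys m. H i ^ Poly_Mapping.lookup m i)"
    by (intro prod.cong) (auto simp: assms(2))
  then show "Const (Poly_Mapping.lookup F m) *
      (\<Prod>i\<in>Poly_Mapping.keys m. G i ^ Poly_Mapping.lookup m i) =
      Const (Poly_Mapping.lookup F m) * (\<Prod>i\<in>Poly_Mapping.keys m. H i ^ Poly_Mapping.lookup m i)"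
    by simp
qed simp

lemma poly_eval_cong:
  assumes "F \<in> polys n" "\<And>i. i \<le> n \<Longrightarrow> \<sigma> i = \<tau> i"
  shows "poly_eval \<sigma> F = poly_eval \<tau> F"
  unfolding poly_eval_def
proof (rule sum.cong)
  fix m assume "m \<in> Poly_Mapping.keys F"
  then have "Poly_Mapping.keys m \<subseteq> {..n}" using assms(1) by (auto simp: polys_def)
  then have "(\<Prod>i\<in>Poly_Mapping.keys m. \<sigma> i ^ Poly_Mapping.lookup m i) =
      (\<Prod>i\<in>Poly_Mapping.keys m. \<tau> i ^ Poly_Mapping.lookup m i)"
    by (intro prod.cong) (auto simp: assms(2))
  then show "Poly_Mapping.lookup F m * (\<Prod>i\<in>Poly_Mapping.keys m. \<sigma> i ^ Poly_Mapping.lookup m i) =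
      Poly_Mapping.lookup F m * (\<Prod>i\<in>Poly_Mapping.keys m. \<tau> i ^ Poly_Mapping.lookup m i)"
    by simp
qed simp

lemma rational_map_cong:
  "(\<And>i. i \<le> n \<Longrightarrow> F i = G i) \<Longrightarrow> rational_map n F \<longleftrightarrow> rational_map n G"
  unfolding rational_map_def by (metis (no_types, lifting))

lemma rational_map_v_minor:
  fixes a :: "nat \<Rightarrow> nat \<Rightarrow> 'a::idom"
  assumes "offdiag_nonzero n a"
  shows "rational_map n (v_minor n a)"
  unfolding rational_map_def
proof
  show "\<exists>d. \<forall>i\<le>n. form n d (v_minor n a i)" using form_v_minor by blast
  have "poly_eval (\<lambda>j. if j = 0 then 1 else 0) (v_minor n a 0) \<noteq> 0"
    by (rule poly_eval_v_minor_axis[OF assms]) auto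
  then show "\<exists>i\<le>n. v_minor n a i \<noteq> 0" by auto
qed

text \<open>The composite is not identically zero, because both factors fix the coordinate point \<open>e\<^sub>0\<close>.\<close>

lemma v_minor_comp_identity:
  fixes a :: "nat \<Rightarrow> nat \<Rightarrow> 'a::idom"
  assumes n: "n \<ge> 1" and a: "offdiag_nonzero n a"
  shows "rational_map n (rat_comp (v_minor n (flip_coeffs a)) (v_minor n a))"
    and "same_rational_map n (rat_comp (v_minor n (flip_coeffs a)) (v_minor n a)) Var"
proof -
  let ?u = "v_minor n (flip_coeffs a)" and ?v = "v_minor n a"
  show "same_rational_map n (rat_comp ?u ?v) Var"
    using v_minor_comp_proportional[of _ n _ a]
    by (simp add: same_rational_map_def rat_comp_def mult.commute)
  define e :: "nat \<Rightarrow> 'a" where "e j = (if j = 0 then 1 else 0)" for j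
  define e' where "e' j = poly_eval e (?v j)" for j
  have "e' 0 \<noteq> 0"
    unfolding e'_def by (rule poly_eval_v_minor_axis[OF a]) (auto simp: e_def)
  moreover have "e' j = 0" if "j \<le> n" "j \<noteq> 0" for j
    using that n by (simp add: e'_def e_def poly_eval_v_minor_axis_other)
  ultimately have "poly_eval e' (?u 0) \<noteq> 0"
    by (intro poly_eval_v_minor_axis[OF offdiag_nonzero_flip[OF a]]) auto
  then have "poly_eval e (rat_comp ?u ?v 0) \<noteq> 0"
    by (simp add: rat_comp_def poly_eval_subst e'_def[abs_def])
  then have "rat_comp ?u ?v 0 \<noteq> 0" by auto
  moreover have "form n (n * n) (rat_comp ?u ?v i)" if "i \<le> n" for i
    unfolding rat_comp_def by (intro form_poly_subst form_v_minor that)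
  ultimately show "rational_map n (rat_comp ?u ?v)"
    unfolding rational_map_def by auto
qed

text \<open>Flipping the coefficients twice changes nothing, so one composite suffices.\<close>

lemma inverse_u_map_v_map:
  fixes a :: "nat \<Rightarrow> nat \<Rightarrow> 'a::idom"
  assumes n: "n \<ge> 1" and a: "offdiag_nonzero n a"
  shows "inverse_rational_maps n (u_map n a) (v_map n a)"
proof -
  let ?u = "v_minor n (flip_coeffs a)" and ?v = "v_minor n a"
  have u: "u_map n a = ?u"
    by (rule ext) (rule u_map_eq_v_minor[OF n a])
  have v: "v_map n a i = ?v i" if "i \<le> n" for i
    by (rule v_map_eq_v_minor[OF n that])
  have uv: "rat_comp ?u (v_map n a) i = rat_comp ?u ?v i" if "i \<le> n" for i
    unfolding rat_comp_def using form_v_minor[OF that] v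
    by (intro poly_subst_cong[of _ n]) (auto simp: form_def)
  have vu: "rat_comp (v_map n a) ?u i = rat_comp ?v ?u i" if "i \<le> n" for i
    using v[OF that] by (simp add: rat_comp_def)
  have flip: "offdiag_nonzero n (flip_coeffs a)"
    using a by (rule offdiag_nonzero_flip)
  have "rational_map n (v_map n a)"
    using rational_map_v_minor[OF a] v by (simp cong: rational_map_cong)
  moreover have "rational_map n (rat_comp (v_map n a) ?u)"
    using v_minor_comp_identity(1)[OF n flip] vu by (simp cong: rational_map_cong)
  moreover have "rational_map n (rat_comp ?u (v_map n a))"
    using v_minor_comp_identity(1)[OF n a] uv by (simp cong: rational_map_cong)
  moreover have "same_rational_map n (rat_comp (v_map n a) ?u) Var"
    using v_minor_comp_identity(2)[OF n flip] by (simp add: same_rational_map_def vu)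
  moreover have "same_rational_map n (rat_comp ?u (v_map n a)) Var"
    using v_minor_comp_identity(2)[OF n a] by (simp add: same_rational_map_def uv)
  ultimately show ?thesis
    unfolding inverse_rational_maps_def u using rational_map_v_minor[OF flip] by blast
qed

section \<open>Nonzero polynomials have nonzero values\<close>

lemma monom_eval_mult: "monom_eval (\<lambda>i. \<sigma> i * \<tau> i) m = monom_eval \<sigma> m * monom_eval \<tau> m"
  by (simp add: monom_eval_def power_mult_distrib prod.distrib)

lemma monom_eval_separates:
  fixes m m' :: "'x \<Rightarrow>\<^sub>0 nat"
  assumes "m \<noteq> m'"
  shows "\<exists>\<sigma> :: 'x \<Rightarrow> 'a::{idom, ring_char_0}. monom_eval \<sigma> m \<noteq> monom_eval \<sigma> m'"
proof -
  obtain i where i: "Poly_Mapping.lookup m i \<noteq> Poly_Mapping.lookup m' i"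
    using assms by (meson poly_mapping_eqI)
  define \<sigma> :: "'x \<Rightarrow> 'a" where "\<sigma> j = (if j = i then 2 else 1)" for j
  have eval: "monom_eval \<sigma> k = of_nat (2 ^ Poly_Mapping.lookup k i)" for k
  proof -
    have "monom_eval \<sigma> k = (\<Prod>j\<in>insert i (Poly_Mapping.keys k). \<sigma> j ^ Poly_Mapping.lookup k j)"
      by (rule monom_eval_superset) auto
    also have "\<dots> = (\<Prod>j\<in>{i}. \<sigma> j ^ Poly_Mapping.lookup k j)"
      by (intro prod.mono_neutral_right) (auto simp: \<sigma>_def)
    finally show ?thesis by (simp add: \<sigma>_def)
  qed
  have "monom_eval \<sigma> m \<noteq> monom_eval \<sigma> m'"
    unfolding eval of_nat_eq_iff using i by simp
  then show ?thesis by blast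
qed

text \<open>Monomials are distinct multiplicative functions of the point, so Artin's argument for
  the linear independence of characters applies: comparing the relation at \<open>\<tau> \<sigma>\<close> with \<open>\<chi>(\<tau>)\<close>
  times the relation at \<open>\<sigma>\<close> removes the monomial \<open>\<chi>\<close>.\<close>

lemma monom_eval_independent:
  fixes c :: "('x \<Rightarrow>\<^sub>0 nat) \<Rightarrow> 'a::{idom, ring_char_0}"
  assumes "finite S" "\<And>\<sigma>. (\<Sum>m\<in>S. c m * monom_eval \<sigma> m) = 0" "m \<in> S"
  shows "c m = 0"
  using assms
proof (induction S arbitrary: c m rule: finite_induct)
  case empty
  then show ?case by simp
next
  case (insert k S)
  have S: "c m = 0" if m: "m \<in> S" for m
  proof -
    from m insert.hyps(2) have "m \<noteq> k" by auto
    then obtain \<tau> :: "'x \<Rightarrow> 'a" where \<tau>: "monom_eval \<tau> m \<noteq> monom_eval \<tau> k"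
      using monom_eval_separates by blast
    have "(\<Sum>m\<in>S. c m * (monom_eval \<tau> m - monom_eval \<tau> k) * monom_eval \<sigma> m) = 0" for \<sigma>
    proof -
      have "(\<Sum>m\<in>S. c m * (monom_eval \<tau> m - monom_eval \<tau> k) * monom_eval \<sigma> m) =
          (\<Sum>m\<in>insert k S. c m * (monom_eval \<tau> m - monom_eval \<tau> k) * monom_eval \<sigma> m)"
        using insert.hyps by simp
      also have "\<dots> = (\<Sum>m\<in>insert k S. c m * monom_eval (\<lambda>i. \<tau> i * \<sigma> i) m) -
          monom_eval \<tau> k * (\<Sum>m\<in>insert k S. c m * monom_eval \<sigma> m)"
        unfolding sum_distrib_left sum_subtractf[symmetric] monom_eval_mult
        by (intro sum.cong) (simp_all add: algebra_simps)
      also have "\<dots> = 0" using insert.prems(1) by simp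
      finally show ?thesis .
    qed
    from insert.IH[OF this m] \<tau> show ?thesis by simp
  qed
  have "c k = 0"
    using insert.prems(1)[of "\<lambda>_. 1"] insert.hyps S by (simp add: monom_eval_def)
  with S insert.prems(2) show ?case by auto
qed

lemma poly_eval_eq_0_imp:
  fixes F :: "('x, 'a::{idom, ring_char_0}) mpoly"
  assumes "\<And>\<sigma>. poly_eval \<sigma> F = 0"
  shows "F = 0"
proof (rule poly_mapping_eqI)
  fix m
  have "Poly_Mapping.lookup F m = 0" if "m \<in> Poly_Mapping.keys F"
    using monom_eval_independent[OF _ _ that, of "Poly_Mapping.lookup F"] assms
    by (simp add: poly_eval_def monom_eval_def)
  then show "Poly_Mapping.lookup F m = Poly_Mapping.lookup 0 m"
    by (auto simp: in_keys_iff)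
qed


section \<open>The ideal of a subspace of codimension 2\<close>

lemma polys_0: "0 \<in> polys n"
  by (simp add: polys_def)

lemma polys_1: "1 \<in> polys n"
  by (simp add: polys_def)

lemma polys_Const: "Const c \<in> polys n"
  by (simp add: polys_def Const_def)

lemma polys_Var: "i \<le> n \<Longrightarrow> Var i \<in> polys n"
  by (simp add: polys_def Var_def)

lemma polys_add: "F \<in> polys n \<Longrightarrow> G \<in> polys n \<Longrightarrow> F + G \<in> polys n"
  using Poly_Mapping.keys_add[of F G] unfolding polys_def by blast

lemma polys_diff: "F \<in> polys n \<Longrightarrow> G \<in> polys n \<Longrightarrow> F - G \<in> polys n"
  for F :: "(nat, 'a::ab_group_add) mpoly"
  using keys_diff[of F G] unfolding polys_def by blast

lemma polys_mult: "F \<in> polys n \<Longrightarrow> G \<in> polys n \<Longrightarrow> F * G \<in> polys n"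
proof -
  assume *: "F \<in> polys n" "G \<in> polys n"
  have "Poly_Mapping.keys m \<subseteq> {..n}" if m: "m \<in> Poly_Mapping.keys (F * G)" for m
  proof -
    obtain p q where "m = p + q" "p \<in> Poly_Mapping.keys F" "q \<in> Poly_Mapping.keys G"
      using keys_mult[of F G] m by blast
    then show ?thesis
      using * Poly_Mapping.keys_add[of p q] by (fastforce simp: polys_def)
  qed
  then show ?thesis by (simp add: polys_def)
qed

lemma polys_power: "F \<in> polys n \<Longrightarrow> F ^ k \<in> polys n"
  by (induction k) (auto intro: polys_1 polys_mult)

lemma polys_prod: "(\<And>i. i \<in> A \<Longrightarrow> F i \<in> polys n) \<Longrightarrow> (\<Prod>i\<in>A. F i) \<in> polys n"
  by (induction A rule: infinite_finite_induct) (auto intro: polys_1 polys_mult)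

lemma polys_lin_f: "lin_f n a i \<in> polys n"
  using form_lin_f by (auto simp: form_def)

lemma ideal2_0: "0 \<in> ideal2 n g h"
  unfolding ideal2_def using polys_0[of n] by force

lemma ideal2_add: "x \<in> ideal2 n g h \<Longrightarrow> y \<in> ideal2 n g h \<Longrightarrow> x + y \<in> ideal2 n g h"
proof -
  assume "x \<in> ideal2 n g h" "y \<in> ideal2 n g h"
  then obtain P R P' R' where xy: "x = P * g + R * h" "y = P' * g + R' * h"
    and "P \<in> polys n" "R \<in> polys n" "P' \<in> polys n" "R' \<in> polys n"
    unfolding ideal2_def by blast
  then have "P + P' \<in> polys n" "R + R' \<in> polys n" by (auto intro: polys_add)
  moreover have "x + y = (P + P') * g + (R + R') * h"
    by (simp add: xy algebra_simps)
  ultimately show ?thesis unfolding ideal2_def by blast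
qed

lemma ideal2_mult: "F \<in> polys n \<Longrightarrow> x \<in> ideal2 n g h \<Longrightarrow> F * x \<in> ideal2 n g h"
proof -
  assume F: "F \<in> polys n" and "x \<in> ideal2 n g h"
  then obtain P R where x: "x = P * g + R * h" and "P \<in> polys n" "R \<in> polys n"
    unfolding ideal2_def by blast
  with F have "F * P \<in> polys n" "F * R \<in> polys n" by (auto intro: polys_mult)
  moreover have "F * x = (F * P) * g + (F * R) * h"
    by (simp add: x algebra_simps)
  ultimately show ?thesis unfolding ideal2_def by blast
qed

lemma ideal2_sum: "(\<And>i. i \<in> A \<Longrightarrow> F i \<in> ideal2 n g h) \<Longrightarrow> (\<Sum>i\<in>A. F i) \<in> ideal2 n g h"
  by (induction A rule: infinite_finite_induct) (auto intro: ideal2_0 ideal2_add)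

lemma ideal2_diff_mult:
  assumes "x - y \<in> ideal2 n g h" "x' - y' \<in> ideal2 n g h" "x' \<in> polys n" "y \<in> polys n"
  shows "x * x' - y * y' \<in> ideal2 n g h"
proof -
  have "x * x' - y * y' = x' * (x - y) + y * (x' - y')"
    by (simp add: algebra_simps)
  then show ?thesis using assms by (auto intro: ideal2_add ideal2_mult)
qed

lemma prod_Var_power:
  "finite A \<Longrightarrow> (\<Prod>i\<in>A. Var i ^ f i) =
     (Poly_Mapping.single (\<Sum>i\<in>A. Poly_Mapping.single i (f i)) 1 :: ('x, 'a::comm_ring_1) mpoly)"
proof (induction A rule: finite_induct)
  case (insert i A)
  have "Var i ^ k = (Poly_Mapping.single (Poly_Mapping.single i k) 1 :: ('x, 'a) mpoly)" for k
    by (induction k) (simp_all add: Var_def mult_single flip: single_add)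
  with insert show ?case by (simp add: mult_single)
qed simp

lemma poly_subst_Var_id: "poly_subst Var F = F"
proof -
  have "(\<Prod>i\<in>Poly_Mapping.keys m. Var i ^ Poly_Mapping.lookup m i) =
      (Poly_Mapping.single m 1 :: ('a, 'b) mpoly)" for m
    by (simp add: prod_Var_power flip: poly_mapping_sum_single)
  then have "poly_subst Var F =
      (\<Sum>m\<in>Poly_Mapping.keys F. Poly_Mapping.single m (Poly_Mapping.lookup F m))"
    by (simp add: poly_subst_def Const_def mult_single)
  then show ?thesis by (simp flip: poly_mapping_sum_single)
qed

text \<open>Substituting congruent elements into a polynomial changes it only by an element of the ideal.\<close>

lemma diff_poly_subst_in_ideal2:
  assumes F: "F \<in> polys n" and G: "\<And>i. i \<le> n \<Longrightarrow> G i \<in> polys n"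
    and diff: "\<And>i. i \<le> n \<Longrightarrow> Var i - G i \<in> ideal2 n g h"
  shows "F - poly_subst G F \<in> ideal2 n g h"
proof -
  have pow: "Var i ^ k - G i ^ k \<in> ideal2 n g h" if "i \<le> n" for i k
    by (induction k) (use that in
      \<open>auto intro!: ideal2_diff_mult ideal2_0 diff polys_power polys_Var G\<close>)
  have prod: "(\<Prod>i\<in>A. Var i ^ f i) - (\<Prod>i\<in>A. G i ^ f i) \<in> ideal2 n g h"
    if "finite A" "A \<subseteq> {..n}" for A f
    using that
  proof (induction A rule: finite_induct)
    case empty
    then show ?case by (simp add: ideal2_0)
  next
    case (insert i A)
    from insert.hyps have
      "(\<Prod>i\<in>insert i A. Var i ^ f i) - (\<Prod>i\<in>insert i A. G i ^ f i) =
       Var i ^ f i * (\<Prod>i\<in>A. Var i ^ f i) - G i ^ f i * (\<Prod>i\<in>A. G i ^ f i)"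
      by simp
    also have "\<dots> \<in> ideal2 n g h"
      using insert by (intro ideal2_diff_mult pow polys_prod polys_power polys_Var G) auto
    finally show ?case .
  qed
  have "F - poly_subst G F = poly_subst Var F - poly_subst G F"
    by (simp add: poly_subst_Var_id)
  also have "\<dots> = (\<Sum>m\<in>Poly_Mapping.keys F. Const (Poly_Mapping.lookup F m) *
      ((\<Prod>i\<in>Poly_Mapping.keys m. Var i ^ Poly_Mapping.lookup m i) -
       (\<Prod>i\<in>Poly_Mapping.keys m. G i ^ Poly_Mapping.lookup m i)))"
    by (simp add: poly_subst_def sum_subtractf right_diff_distrib)
  also have "\<dots> \<in> ideal2 n g h"
    using F by (intro ideal2_sum ideal2_mult polys_Const prod) (auto simp: polys_def)
  finally show ?thesis .
qed

text \<open>Modulo the ideal, \<open>x\<^sub>i\<close> and one further variable \<open>x\<^sub>k\<close> can be eliminated. The eliminating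
  substitution parametrizes the subspace by all of affine space, so a polynomial that vanishes on
  the subspace becomes a polynomial without nonzero values, which is zero.\<close>

lemma vanishing_ideal_subspace:
  fixes a :: "nat \<Rightarrow> nat \<Rightarrow> 'a::field_char_0"
  assumes i: "i \<le> n" and k: "k \<le> n" "k \<noteq> i" and aik: "a i k \<noteq> 0"
  shows "vanishing_ideal n
      {z \<in> carrier_vec (Suc n). z $ i = 0 \<and> (\<Sum>j\<in>{..n} - {i}. a i j * z $ j) = 0} =
    ideal2 n (Var i) (lin_f n a i)" (is "vanishing_ideal n ?V = ?I")
proof
  have eval_lin: "poly_eval \<sigma> (lin_f n a i) = (\<Sum>j\<in>{..n} - {i}. a i j * \<sigma> j)" for \<sigma>
    by (simp add: lin_f_def poly_eval.hom_sum poly_eval.hom_mult)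
  show "?I \<subseteq> vanishing_ideal n ?V"
  proof
    fix F assume "F \<in> ?I"
    then obtain P R where F: "F = P * Var i + R * lin_f n a i" and "P \<in> polys n" "R \<in> polys n"
      unfolding ideal2_def by blast
    then have "F \<in> polys n"
      using i by (auto intro: polys_add polys_mult polys_Var polys_lin_f)
    then show "F \<in> vanishing_ideal n ?V"
      by (auto simp: vanishing_ideal_def F poly_eval.hom_add poly_eval.hom_mult eval_lin)
  qed
  show "vanishing_ideal n ?V \<subseteq> ?I"
  proof
    fix F assume F: "F \<in> vanishing_ideal n ?V"
    then have Fpoly: "F \<in> polys n" by (simp add: vanishing_ideal_def)
    define G :: "nat \<Rightarrow> (nat, 'a) mpoly" where
      "G j = (if j = i then 0 else if j = k then Var k - Const (inverse (a i k)) * lin_f n a i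
        else Var j)" for j
    have "poly_eval \<sigma> (poly_subst G F) = 0" for \<sigma>
    proof -
      define z where "z = vec (Suc n) (\<lambda>j. poly_eval \<sigma> (G j))"
      let ?f = "\<Sum>j\<in>{..n} - {i}. a i j * \<sigma> j"
      have z: "z $ j = (if j = i then 0 else if j = k then \<sigma> k - inverse (a i k) * ?f else \<sigma> j)"
        if "j \<le> n" for j
        using that by (simp add: z_def G_def eval_lin poly_eval.hom_minus poly_eval.hom_mult)
      have "(\<Sum>j\<in>{..n} - {i}. a i j * z $ j) =
          (\<Sum>j\<in>{..n} - {i}. a i j * \<sigma> j - (if j = k then ?f else 0))"
        using aik by (intro sum.cong) (auto simp: z right_diff_distrib)
      also have "\<dots> = 0"
        using k by (simp add: sum_subtractf)
      finally have "z \<in> ?V"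
        using i by (simp add: z) (simp add: z_def)
      then have "poly_eval (\<lambda>j. z $ j) F = 0"
        using F by (simp add: vanishing_ideal_def)
      moreover have "poly_eval (\<lambda>j. poly_eval \<sigma> (G j)) F = poly_eval (\<lambda>j. z $ j) F"
        by (rule poly_eval_cong[OF Fpoly]) (simp add: z_def)
      ultimately show ?thesis by (simp add: poly_eval_subst)
    qed
    then have subst0: "poly_subst G F = 0"
      by (rule poly_eval_eq_0_imp)
    have Var_i: "Var i \<in> ?I"
      unfolding ideal2_def using polys_0[of n] polys_1[of n] by force
    have "lin_f n a i \<in> ?I"
      unfolding ideal2_def using polys_0[of n] polys_1[of n] by force
    then have "Var j - G j \<in> ?I" for j
      using Var_i by (auto simp: G_def ideal2_0 intro: ideal2_mult polys_Const)
    moreover have "G j \<in> polys n" if "j \<le> n" for j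
      using that by (auto simp: G_def
          intro!: polys_0 polys_diff polys_mult polys_Const polys_Var polys_lin_f)
    ultimately have "F - poly_subst G F \<in> ?I"
      by (intro diff_poly_subst_in_ideal2[OF Fpoly]) auto
    then show "F \<in> ?I" by (simp add: subst0)
  qed
qed

section \<open>Frames in adapted position\<close>

definition coord_mat :: "nat \<Rightarrow> (nat \<times> nat \<times> nat \<Rightarrow> 'a) \<Rightarrow> 'a mat" where
  "coord_mat n c = mat (Suc n) (Suc n) (\<lambda>(i, j). c (i, 0, j))"

text \<open>Taking the first form of every pair as a coordinate, the second form of the \<open>i\<close>-th pair has
  these coefficients in the new coordinates, up to the common factor \<open>det (coord_mat n c)\<close>, which
  keeps them polynomial in \<open>c\<close>.\<close>

definition second_coeff ::
  "nat \<Rightarrow> (nat \<times> nat \<times> nat \<Rightarrow> 'a::comm_ring_1) \<Rightarrow> nat \<Rightarrow> nat \<Rightarrow> 'a" where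
  "second_coeff n c i j = (\<Sum>k<Suc n. c (i, 1, k) * cofactor (coord_mat n c) j k)"

text \<open>The first factor is nonzero iff the first forms are coordinates; the others then are the
  coefficients \<open>a\<^sub>i\<^sub>j\<close>, up to scaling, that have to be nonzero.\<close>

definition frame_discr :: "nat \<Rightarrow> (nat \<times> nat \<times> nat \<Rightarrow> 'a::comm_ring_1) \<Rightarrow> 'a" where
  "frame_discr n c = det (coord_mat n c) * (\<Prod>i\<le>n. \<Prod>j\<in>{..n} - {i}. second_coeff n c i j)"

definition change_frame ::
  "(nat \<Rightarrow> nat \<Rightarrow> nat \<Rightarrow> 'a::comm_ring_1) \<Rightarrow> (nat \<times> nat \<times> nat \<Rightarrow> 'a) \<Rightarrow> nat \<times> nat \<times> nat \<Rightarrow> 'a" where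
  "change_frame h c = (\<lambda>(i, k, j). h i k 0 * c (i, 0, j) + h i k 1 * c (i, 1, j))"

lemma coord_mat_carrier: "coord_mat n c \<in> carrier_mat (Suc n) (Suc n)"
  by (simp add: coord_mat_def)

lemma coord_mat_mult_vec:
  assumes "i \<le> n"
  shows "(coord_mat n c *\<^sub>v p) $ i = frame_form n c i 0 \<bullet> p"
proof -
  have "row (coord_mat n c) i = frame_form n c i 0"
    using assms by (intro eq_vecI) (auto simp: coord_mat_def frame_form_def)
  then show ?thesis using assms by (simp add: coord_mat_def)
qed

lemma second_form_in_coordinates:
  assumes p: "p \<in> carrier_vec (Suc n)"
  shows "det (coord_mat n c) * (frame_form n c i 1 \<bullet> p) =
    (\<Sum>j<Suc n. second_coeff n c i j * (coord_mat n c *\<^sub>v p) $ j)"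
proof -
  let ?A = "coord_mat n c"
  have A: "?A \<in> carrier_mat (Suc n) (Suc n)" by (rule coord_mat_carrier)
  have adj: "(\<Sum>j<Suc n. cofactor ?A j k * (?A *\<^sub>v p) $ j) = det ?A * p $ k" if k: "k < Suc n" for k
  proof -
    have "(adj_mat ?A *\<^sub>v (?A *\<^sub>v p)) $ k = (\<Sum>j<Suc n. cofactor ?A j k * (?A *\<^sub>v p) $ j)"
      using k A by (simp add: adj_mat_def scalar_prod_def lessThan_atLeast0)
    moreover have "adj_mat ?A *\<^sub>v (?A *\<^sub>v p) = det ?A \<cdot>\<^sub>v p"
      unfolding assoc_mult_mat_vec[OF adj_mat(1)[OF A] A p, symmetric] adj_mat(3)[OF A]
      using p by (intro eq_vecI) auto
    ultimately show ?thesis using k p by simp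
  qed
  have "(\<Sum>j<Suc n. second_coeff n c i j * (?A *\<^sub>v p) $ j) =
      (\<Sum>k<Suc n. c (i, 1, k) * (\<Sum>j<Suc n. cofactor ?A j k * (?A *\<^sub>v p) $ j))"
    unfolding second_coeff_def sum_distrib_right sum_distrib_left
    by (subst sum.swap) (simp only: mult.assoc)
  also have "\<dots> = (\<Sum>k<Suc n. c (i, 1, k) * (det ?A * p $ k))"
    by (intro sum.cong) (simp_all only: adj lessThan_iff)
  also have "\<dots> = det ?A * (frame_form n c i 1 \<bullet> p)"
    using p by (simp add: scalar_prod_def frame_form_def sum_distrib_left lessThan_atLeast0
        mult.left_commute del: sum.atLeast0_lessThan_Suc sum.op_ivl_Suc)
  finally show ?thesis by simp
qed

lemma frame_discr_nonzero:
  fixes c :: "nat \<times> nat \<times> nat \<Rightarrow> 'a::idom"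
  assumes "frame_discr n c \<noteq> 0"
  shows "det (coord_mat n c) \<noteq> 0" "offdiag_nonzero n (second_coeff n c)"
  using assms by (auto simp: frame_discr_def offdiag_nonzero_def)

lemma inverse_coord_mat:
  fixes c :: "nat \<times> nat \<times> nat \<Rightarrow> 'a::field"
  assumes "det (coord_mat n c) \<noteq> 0"
  obtains A' where "A' \<in> carrier_mat (Suc n) (Suc n)"
    "coord_mat n c * A' = 1\<^sub>m (Suc n)" "A' * coord_mat n c = 1\<^sub>m (Suc n)"
proof
  let ?A = "coord_mat n c"
  let ?A' = "inverse (det ?A) \<cdot>\<^sub>m adj_mat ?A"
  note A = coord_mat_carrier[of n c]
  show "?A' \<in> carrier_mat (Suc n) (Suc n)" using adj_mat(1)[OF A] by simp
  show "?A * ?A' = 1\<^sub>m (Suc n)"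
    using adj_mat(1,2)[OF A] A assms
    by (simp add: mult_smult_distrib[OF A adj_mat(1)[OF A]]) (intro eq_matI; auto)
  show "?A' * ?A = 1\<^sub>m (Suc n)"
    using adj_mat(1,3)[OF A] A assms
    by (simp add: mult_smult_assoc_mat[OF adj_mat(1)[OF A] A]) (intro eq_matI; auto)
qed

lemma coord_mat_surj:
  fixes c :: "nat \<times> nat \<times> nat \<Rightarrow> 'a::field"
  assumes "det (coord_mat n c) \<noteq> 0" and z: "z \<in> carrier_vec (Suc n)"
  obtains p where "p \<in> carrier_vec (Suc n)" "coord_mat n c *\<^sub>v p = z"
proof -
  obtain A' where A': "A' \<in> carrier_mat (Suc n) (Suc n)" "coord_mat n c * A' = 1\<^sub>m (Suc n)"
    using inverse_coord_mat[OF assms(1)] by metis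
  have "coord_mat n c *\<^sub>v (A' *\<^sub>v z) = z"
    using assoc_mult_mat_vec[OF coord_mat_carrier A'(1) z, of c] A'(2) z by simp
  moreover have "A' *\<^sub>v z \<in> carrier_vec (Suc n)" using A'(1) z by simp
  ultimately show thesis using that by blast
qed

lemma is_frame_of_discr:
  fixes c :: "nat \<times> nat \<times> nat \<Rightarrow> 'a::field"
  assumes n: "n \<ge> 1" and D: "frame_discr n c \<noteq> 0"
  shows "is_frame n c"
  unfolding is_frame_def indep2_def
proof (intro allI impI)
  let ?A = "coord_mat n c"
  note nz = frame_discr_nonzero[OF D]
  fix i s t
  assume i: "i \<le> n" and
    rel: "s \<cdot>\<^sub>v frame_form n c i 0 + t \<cdot>\<^sub>v frame_form n c i 1 = 0\<^sub>v (Suc n)"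
  have forms: "frame_form n c i k \<in> carrier_vec (Suc n)" for k
    by (simp add: frame_form_def)
  have key: "s * det ?A * z $ i + t * (\<Sum>j<Suc n. second_coeff n c i j * z $ j) = 0"
    if z: "z \<in> carrier_vec (Suc n)" for z
  proof -
    obtain p where p: "p \<in> carrier_vec (Suc n)" "?A *\<^sub>v p = z"
      using coord_mat_surj[OF nz(1) z] .
    have "0 = (s \<cdot>\<^sub>v frame_form n c i 0 + t \<cdot>\<^sub>v frame_form n c i 1) \<bullet> p"
      unfolding rel using p by simp
    also have "\<dots> = s * (frame_form n c i 0 \<bullet> p) + t * (frame_form n c i 1 \<bullet> p)"
      using forms p(1) by (simp add: add_scalar_prod_distrib[of _ "Suc n"])
    finally have "0 = det ?A * (s * (frame_form n c i 0 \<bullet> p) + t * (frame_form n c i 1 \<bullet> p))"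
      by simp
    also have "\<dots> = s * det ?A * (frame_form n c i 0 \<bullet> p) +
        t * (det ?A * (frame_form n c i 1 \<bullet> p))"
      by (simp add: algebra_simps)
    finally show ?thesis
      using second_form_in_coordinates[OF p(1), of c i] coord_mat_mult_vec[OF i, of c p] p(2)
      by simp
  qed
  define k where "k = (if i = 0 then 1 else 0 :: nat)"
  have k: "k \<le> n" "k \<noteq> i" using n by (auto simp: k_def)
  have unit: "(\<Sum>j<Suc n. second_coeff n c i j * unit_vec (Suc n) r $ j) = second_coeff n c i r"
    if "r \<le> n" for r
  proof -
    have "(\<Sum>j<Suc n. second_coeff n c i j * unit_vec (Suc n) r $ j) =
        (\<Sum>j\<in>{r}. second_coeff n c i j * unit_vec (Suc n) r $ j)"
      using that by (intro sum.mono_neutral_right) (auto simp: unit_vec_def)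
    then show ?thesis using that by simp
  qed
  have "t * second_coeff n c i k = 0"
    using key[OF unit_vec_carrier, of k] k i unfolding unit[OF k(1)] by simp
  then have t: "t = 0"
    using nz(2) i k by (auto simp: offdiag_nonzero_def)
  have "s * det ?A = 0"
    using key[of "unit_vec (Suc n) i"] i t by simp
  with nz(1) t show "s = 0 \<and> t = 0" by simp
qed

text \<open>A scalar multiple of the second form is as good as the form itself, so \<open>second_coeff\<close>
  can serve as the coefficients \<open>a\<close>.\<close>

lemma adapted_coordinates_of_discr:
  fixes c :: "nat \<times> nat \<times> nat \<Rightarrow> 'a::field_char_0"
  assumes n: "n \<ge> 1" and D: "frame_discr n c \<noteq> 0"
  shows "adapted_coordinates n (frame_tuple n c) (coord_mat n c) (second_coeff n c)"
  unfolding adapted_coordinates_def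
proof (intro conjI allI impI)
  let ?A = "coord_mat n c" and ?a = "second_coeff n c"
  note nz = frame_discr_nonzero[OF D]
  show "?A \<in> carrier_mat (Suc n) (Suc n)" by (rule coord_mat_carrier)
  obtain A' where A': "A' \<in> carrier_mat (Suc n) (Suc n)"
    "?A * A' = 1\<^sub>m (Suc n)" "A' * ?A = 1\<^sub>m (Suc n)"
    using inverse_coord_mat[OF nz(1)] .
  then show "invertible_mat ?A"
    unfolding invertible_mat_def inverts_mat_def
    by (intro conjI exI[of _ A']) (auto simp: coord_mat_def)
  show "?a i j \<noteq> 0" if "i \<le> n" "j \<le> n" "i \<noteq> j" for i j
    using nz(2) that by (auto simp: offdiag_nonzero_def)
  fix i assume i: "i \<le> n"
  have mem: "p \<in> frame_tuple n c i \<longleftrightarrow>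
      (?A *\<^sub>v p) $ i = 0 \<and> (\<Sum>j\<in>{..n} - {i}. ?a i j * (?A *\<^sub>v p) $ j) = 0"
    if p: "p \<in> carrier_vec (Suc n)" for p
  proof -
    have "det ?A * (frame_form n c i 1 \<bullet> p) =
        ?a i i * (?A *\<^sub>v p) $ i + (\<Sum>j\<in>{..n} - {i}. ?a i j * (?A *\<^sub>v p) $ j)"
      using second_form_in_coordinates[OF p, of c i] by (simp only: sum_lessThan_Suc_remove[OF i])
    moreover have "p \<in> frame_tuple n c i \<longleftrightarrow>
        (?A *\<^sub>v p) $ i = 0 \<and> det ?A * (frame_form n c i 1 \<bullet> p) = 0"
      using i p nz(1) by (simp add: frame_tuple_def zero_locus2_def coord_mat_mult_vec)
    ultimately show ?thesis by auto
  qed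
  have carrier: "frame_tuple n c i \<subseteq> carrier_vec (Suc n)"
    using i by (auto simp: frame_tuple_def zero_locus2_def)
  have "(\<lambda>p. ?A *\<^sub>v p) ` frame_tuple n c i =
      {z \<in> carrier_vec (Suc n). z $ i = 0 \<and> (\<Sum>j\<in>{..n} - {i}. ?a i j * z $ j) = 0}"
    (is "_ = ?V")
  proof (intro equalityI subsetI)
    fix z assume "z \<in> (\<lambda>p. ?A *\<^sub>v p) ` frame_tuple n c i"
    then obtain p where p: "p \<in> frame_tuple n c i" "z = ?A *\<^sub>v p" by blast
    with carrier have "p \<in> carrier_vec (Suc n)" by blast
    with p mem coord_mat_carrier[of n c] show "z \<in> ?V" by auto
  next
    fix z assume z: "z \<in> ?V"
    then obtain p where p: "p \<in> carrier_vec (Suc n)" "?A *\<^sub>v p = z"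
      using coord_mat_surj[OF nz(1), of z] by blast
    with z mem[OF p(1)] show "z \<in> (\<lambda>p. ?A *\<^sub>v p) ` frame_tuple n c i" by auto
  qed
  moreover define k where "k = (if i = 0 then 1 else 0 :: nat)"
  have "k \<le> n" "k \<noteq> i" using n by (auto simp: k_def)
  ultimately show "vanishing_ideal n ((\<lambda>p. ?A *\<^sub>v p) ` frame_tuple n c i) =
      ideal2 n (Var i) (lin_f n ?a i)"
    using vanishing_ideal_subspace[OF i, of k ?a] nz(2) i by (simp add: offdiag_nonzero_def)
qed

section \<open>The open set of tuples with an adapted frame\<close>

lemma frame_form_carrier: "frame_form n c i k \<in> carrier_vec (Suc n)"
  by (simp add: frame_form_def)

lemma frame_form_change_frame:
  "frame_form n (change_frame h c) i k =
     h i k 0 \<cdot>\<^sub>v frame_form n c i 0 + h i k 1 \<cdot>\<^sub>v frame_form n c i 1"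
  by (intro eq_vecI) (auto simp: frame_form_def change_frame_def)

lemma indep2_nonzero_minor:
  fixes l m :: "'a::field vec"
  assumes carr: "l \<in> carrier_vec (Suc n)" "m \<in> carrier_vec (Suc n)" and ind: "indep2 n l m"
  obtains j k where "j \<le> n" "k \<le> n" "l $ j * m $ k - l $ k * m $ j \<noteq> 0"
proof -
  have "\<exists>j\<le>n. l $ j \<noteq> 0"
  proof (rule ccontr)
    assume "\<not> ?thesis"
    then have "1 \<cdot>\<^sub>v l + 0 \<cdot>\<^sub>v m = 0\<^sub>v (Suc n)"
      using carr by (intro eq_vecI) auto
    with ind show False unfolding indep2_def by (metis zero_neq_one)
  qed
  then obtain j where j: "j \<le> n" "l $ j \<noteq> 0" by blast
  have "\<exists>k\<le>n. l $ j * m $ k - l $ k * m $ j \<noteq> 0"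
  proof (rule ccontr)
    assume "\<not> ?thesis"
    then have "(- (m $ j)) \<cdot>\<^sub>v l + (l $ j) \<cdot>\<^sub>v m = 0\<^sub>v (Suc n)"
      using carr by (intro eq_vecI) (auto simp: mult.commute)
    with ind j(2) show False unfolding indep2_def by blast
  qed
  with j(1) that show thesis by blast
qed

text \<open>With a nonzero minor in columns \<open>j\<close> and \<open>k\<close>, the vectors
  \<open>\<delta> e\<^sub>r - \<alpha> e\<^sub>j - \<beta> e\<^sub>k\<close> with coefficients from Cramer's rule lie in the zero locus; evaluating \<open>l\<close>
  on them expresses its \<open>r\<close>-th coefficient.\<close>

lemma form_in_span:
  fixes l l' m' :: "'a::field vec"
  assumes carr: "l \<in> carrier_vec (Suc n)" "l' \<in> carrier_vec (Suc n)" "m' \<in> carrier_vec (Suc n)"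
    and ind: "indep2 n l' m'" and van: "\<And>p. p \<in> zero_locus2 n l' m' \<Longrightarrow> l \<bullet> p = 0"
  shows "\<exists>s t. l = s \<cdot>\<^sub>v l' + t \<cdot>\<^sub>v m'"
proof -
  obtain j k where j: "j \<le> n" and k: "k \<le> n" and nz: "l' $ j * m' $ k - l' $ k * m' $ j \<noteq> 0"
    using indep2_nonzero_minor[OF carr(2,3) ind] .
  define \<delta> where "\<delta> = l' $ j * m' $ k - l' $ k * m' $ j"
  define s where "s = (l $ j * m' $ k - l $ k * m' $ j) / \<delta>"
  define t where "t = (l' $ j * l $ k - l' $ k * l $ j) / \<delta>"
  have "l $ r = s * l' $ r + t * m' $ r" if r: "r \<le> n" for r
  proof -
    define \<alpha> where "\<alpha> = l' $ r * m' $ k - l' $ k * m' $ r"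
    define \<beta> where "\<beta> = l' $ j * m' $ r - l' $ r * m' $ j"
    define p where "p = \<delta> \<cdot>\<^sub>v unit_vec (Suc n) r +
      ((- \<alpha>) \<cdot>\<^sub>v unit_vec (Suc n) j + (- \<beta>) \<cdot>\<^sub>v unit_vec (Suc n) k)"
    have p: "w \<bullet> p = \<delta> * w $ r - \<alpha> * w $ j - \<beta> * w $ k" if "w \<in> carrier_vec (Suc n)" for w
      using that r j k by (simp add: p_def scalar_prod_add_distrib[of _ "Suc n"])
    have "p \<in> carrier_vec (Suc n)" by (simp add: p_def)
    then have "p \<in> zero_locus2 n l' m'"
      using carr by (simp add: zero_locus2_def p \<delta>_def \<alpha>_def \<beta>_def algebra_simps)
    then have "\<delta> * l $ r = \<alpha> * l $ j + \<beta> * l $ k"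
      using van p[OF carr(1)] by (simp add: algebra_simps)
    also have "\<dots> = \<delta> * (s * l' $ r + t * m' $ r)"
      using nz by (simp add: s_def t_def \<delta>_def[symmetric] distrib_left)
        (simp add: \<alpha>_def \<beta>_def algebra_simps)
    finally show ?thesis using nz by (simp add: \<delta>_def)
  qed
  then have "l = s \<cdot>\<^sub>v l' + t \<cdot>\<^sub>v m'"
    using carr by (intro eq_vecI) auto
  then show ?thesis by blast
qed

text \<open>A singular coefficient matrix would give a nontrivial relation between the combinations,
  so it is invertible and the two systems of equations are equivalent.\<close>

lemma zero_locus2_combination:
  fixes l m :: "'a::field vec"
  assumes carr: "l \<in> carrier_vec (Suc n)" "m \<in> carrier_vec (Suc n)"
    and ind: "indep2 n (a \<cdot>\<^sub>v l + b \<cdot>\<^sub>v m) (c \<cdot>\<^sub>v l + d \<cdot>\<^sub>v m)"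
  shows "zero_locus2 n (a \<cdot>\<^sub>v l + b \<cdot>\<^sub>v m) (c \<cdot>\<^sub>v l + d \<cdot>\<^sub>v m) = zero_locus2 n l m"
proof -
  have det: "a * d - b * c \<noteq> 0"
  proof
    assume det0: "a * d - b * c = 0"
    have "d \<cdot>\<^sub>v (a \<cdot>\<^sub>v l + b \<cdot>\<^sub>v m) + (- b) \<cdot>\<^sub>v (c \<cdot>\<^sub>v l + d \<cdot>\<^sub>v m) = (a * d - b * c) \<cdot>\<^sub>v l"
      using carr by (intro eq_vecI) (auto simp: algebra_simps)
    also have "\<dots> = 0\<^sub>v (Suc n)" using det0 carr by (intro eq_vecI) auto
    finally have "b = 0" "d = 0" using ind unfolding indep2_def by (metis neg_equal_0_iff_equal)+
    have "c \<cdot>\<^sub>v (a \<cdot>\<^sub>v l + b \<cdot>\<^sub>v m) + (- a) \<cdot>\<^sub>v (c \<cdot>\<^sub>v l + d \<cdot>\<^sub>v m) =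
        (- (a * d - b * c)) \<cdot>\<^sub>v m"
      using carr by (intro eq_vecI) (auto simp: algebra_simps)
    also have "\<dots> = 0\<^sub>v (Suc n)" using det0 carr by (intro eq_vecI) auto
    finally have "a = 0" using ind unfolding indep2_def by (metis neg_equal_0_iff_equal)
    with \<open>b = 0\<close> have "1 \<cdot>\<^sub>v (a \<cdot>\<^sub>v l + b \<cdot>\<^sub>v m) + 0 \<cdot>\<^sub>v (c \<cdot>\<^sub>v l + d \<cdot>\<^sub>v m) = 0\<^sub>v (Suc n)"
      using carr by (intro eq_vecI) auto
    with ind show False unfolding indep2_def by (metis zero_neq_one)
  qed
  have comb: "(x \<cdot>\<^sub>v l + y \<cdot>\<^sub>v m) \<bullet> p = x * (l \<bullet> p) + y * (m \<bullet> p)" if "p \<in> carrier_vec (Suc n)" for x y p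
    using carr that by (simp add: add_scalar_prod_distrib[of _ "Suc n"])
  have uv: "u = 0 \<and> v = 0" if "a * u + b * v = 0" "c * u + d * v = 0" for u v
  proof -
    have "(a * d - b * c) * u = d * (a * u + b * v) - b * (c * u + d * v)"
      by (simp add: algebra_simps)
    also have "\<dots> = 0" unfolding that by simp
    finally have u: "(a * d - b * c) * u = 0" .
    have "(a * d - b * c) * v = a * (c * u + d * v) - c * (a * u + b * v)"
      by (simp add: algebra_simps)
    also have "\<dots> = 0" unfolding that by simp
    finally have "(a * d - b * c) * v = 0" .
    with u det show ?thesis unfolding mult_eq_0_iff by blast
  qed
  show ?thesis
    unfolding zero_locus2_def
  proof (rule Collect_cong, rule conj_cong[OF refl])
    fix p :: "'a vec" assume p: "p \<in> carrier_vec (Suc n)"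
    show "(a \<cdot>\<^sub>v l + b \<cdot>\<^sub>v m) \<bullet> p = 0 \<and> (c \<cdot>\<^sub>v l + d \<cdot>\<^sub>v m) \<bullet> p = 0 \<longleftrightarrow>
        l \<bullet> p = 0 \<and> m \<bullet> p = 0"
      unfolding comb[OF p] using uv[of "l \<bullet> p" "m \<bullet> p"] by auto
  qed
qed

lemma frame_tuple_change_frame:
  fixes c :: "nat \<times> nat \<times> nat \<Rightarrow> 'a::field"
  assumes "is_frame n (change_frame h c)"
  shows "frame_tuple n (change_frame h c) = frame_tuple n c"
  unfolding frame_tuple_def
proof (rule restrict_ext)
  fix i assume "i \<in> {..n}"
  then have "indep2 n (frame_form n (change_frame h c) i 0) (frame_form n (change_frame h c) i 1)"
    using assms by (simp add: is_frame_def)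
  then show "zero_locus2 n (frame_form n (change_frame h c) i 0)
      (frame_form n (change_frame h c) i 1) =
      zero_locus2 n (frame_form n c i 0) (frame_form n c i 1)"
    unfolding frame_form_change_frame
    by (intro zero_locus2_combination frame_form_carrier)
qed

text \<open>Two frames of the same tuple differ by a change of frame in each index, as each form
  of one frame vanishes on the subspace that the other one cuts out.\<close>

lemma frames_of_same_tuple:
  fixes c c' :: "nat \<times> nat \<times> nat \<Rightarrow> 'a::field"
  assumes c': "is_frame n c'" and eq: "frame_tuple n c = frame_tuple n c'"
  shows "\<exists>h. \<forall>i\<le>n. \<forall>k<2. \<forall>j\<le>n. c (i, k, j) = change_frame h c' (i, k, j)"
proof -
  have "\<exists>s t. frame_form n c i k = s \<cdot>\<^sub>v frame_form n c' i 0 + t \<cdot>\<^sub>v frame_form n c' i 1"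
    if i: "i \<le> n" and k: "k < 2" for i k
  proof (rule form_in_span[OF frame_form_carrier frame_form_carrier frame_form_carrier])
    show "indep2 n (frame_form n c' i 0) (frame_form n c' i 1)"
      using c' i by (simp add: is_frame_def)
    fix p assume "p \<in> zero_locus2 n (frame_form n c' i 0) (frame_form n c' i 1)"
    also have "\<dots> = zero_locus2 n (frame_form n c i 0) (frame_form n c i 1)"
      using fun_cong[OF eq, of i] i by (simp add: frame_tuple_def)
    finally show "frame_form n c i k \<bullet> p = 0"
      using k by (cases k) (auto simp: zero_locus2_def)
  qed
  then obtain s t where st: "\<And>i k. i \<le> n \<Longrightarrow> k < 2 \<Longrightarrow>
      frame_form n c i k = s i k \<cdot>\<^sub>v frame_form n c' i 0 + t i k \<cdot>\<^sub>v frame_form n c' i 1"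
    by metis
  define h where "h i k l = (if l = 0 then s i k else t i k)" for i k and l :: nat
  show ?thesis
  proof (intro exI[of _ h] allI impI)
    fix i k j :: nat assume i: "i \<le> n" and k: "k < 2" and j: "j \<le> n"
    have "frame_form n c i k = frame_form n (change_frame h c') i k"
      using st[OF i k] by (simp add: frame_form_change_frame h_def)
    from arg_cong[OF this, of "\<lambda>w. w $ j"] j
    show "c (i, k, j) = change_frame h c' (i, k, j)" by (simp add: frame_form_def)
  qed
qed

lemma frame_discr_cong:
  assumes "\<And>i k j. i \<le> n \<Longrightarrow> k < 2 \<Longrightarrow> j \<le> n \<Longrightarrow> c (i, k, j) = c' (i, k, j)"
  shows "frame_discr n c = frame_discr n c'"
proof -
  have A: "coord_mat n c = coord_mat n c'"
    using assms by (intro eq_matI) (auto simp: coord_mat_def)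
  have "second_coeff n c i j = second_coeff n c' i j" if "i \<le> n" for i j
    unfolding second_coeff_def A using that assms by (intro sum.cong) auto
  then show ?thesis by (simp add: frame_discr_def A)
qed

text \<open>This makes the discriminant of a changed frame a polynomial in the entries of the frame: it is
  the discriminant of the frame of variables over the polynomial ring.\<close>

lemma (in comm_ring_hom) hom_frame_discr:
  "hom (frame_discr n c) = frame_discr n (\<lambda>x. hom (c x))"
proof -
  have A: "coord_mat n (\<lambda>x. hom (c x)) = map_mat hom (coord_mat n c)"
    by (intro eq_matI) (auto simp: coord_mat_def)
  have cof: "cofactor (map_mat hom (coord_mat n c)) j k = hom (cofactor (coord_mat n c) j k)"
    if "j \<le> n" for j k
  proof -
    have "mat_delete (map_mat hom (coord_mat n c)) j k = map_mat hom (mat_delete (coord_mat n c) j k)"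
      using that by (intro eq_matI) (auto simp: mat_delete_def coord_mat_def)
    then show ?thesis by (simp add: cofactor_def hom_distribs)
  qed
  have "hom (second_coeff n c i j) = second_coeff n (\<lambda>x. hom (c x)) i j" if "j \<le> n" for i j
    unfolding second_coeff_def A using that by (simp only: hom_sum hom_mult cof)
  then show ?thesis
    by (simp add: frame_discr_def A hom_mult hom_prod)
qed

definition frame_discr_poly ::
  "nat \<Rightarrow> (nat \<Rightarrow> nat \<Rightarrow> nat \<Rightarrow> 'a) \<Rightarrow> (nat \<times> nat \<times> nat, 'a::comm_ring_1) mpoly" where
  "frame_discr_poly n h = frame_discr n (change_frame (\<lambda>i k l. Const (h i k l)) Var)"

lemma poly_eval_frame_discr_poly:
  "poly_eval c (frame_discr_poly n h) = frame_discr n (change_frame h c)"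
  unfolding frame_discr_poly_def poly_eval.hom_frame_discr
  by (rule arg_cong[of _ _ "frame_discr n"])
    (auto simp: change_frame_def poly_eval.hom_add poly_eval.hom_mult)

text \<open>At the frame of the forms \<open>x\<^sub>i\<close> and \<open>x\<^sub>0 + \<dots> + x\<^sub>n\<close>: all factors are \<open>1\<close>, so the discriminant is not
  the zero polynomial.\<close>

lemma frame_discr_standard:
  "frame_discr n (\<lambda>(i, k, j). if k = 0 then (if i = j then 1 else 0) else 1) =
     (1 :: 'a::comm_ring_1)"
proof -
  let ?c = "\<lambda>(i :: nat, k :: nat, j :: nat). if k = 0 then (if i = j then 1 else 0) else 1 :: 'a"
  let ?I = "1\<^sub>m (Suc n) :: 'a mat"
  have A: "coord_mat n ?c = ?I"
    by (intro eq_matI) (auto simp: coord_mat_def)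
  have I: "?I \<in> carrier_mat (Suc n) (Suc n)" by simp
  have "1 \<cdot>\<^sub>m ?I = ?I" by (intro eq_matI) auto
  then have adj: "adj_mat ?I = ?I"
    using adj_mat(2)[OF I] left_mult_one_mat[OF adj_mat(1)[OF I]] by simp
  have cof: "cofactor ?I j k = (if j = k then 1 else 0)" if "j < Suc n" "k < Suc n" for j k
    using that arg_cong[OF adj, of "\<lambda>M. M $$ (k, j)"]
    by (cases "j = k") (simp_all add: adj_mat_def)
  have "second_coeff n ?c i j = 1" if "j \<le> n" for i j
  proof -
    have "second_coeff n ?c i j = (\<Sum>k<Suc n. if j = k then 1 else 0)"
      unfolding second_coeff_def A using that by (intro sum.cong) (simp_all add: cof)
    then show ?thesis using that by (simp del: sum.lessThan_Suc)
  qed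
  then show ?thesis by (simp add: frame_discr_def A)
qed

definition adapted_tuples :: "nat \<Rightarrow> (nat \<Rightarrow> 'a::field_char_0 vec set) set" where
  "adapted_tuples n = {frame_tuple n c | c. frame_discr n c \<noteq> 0}"

lemma frame_tuple_in_param_space: "is_frame n c \<Longrightarrow> frame_tuple n c \<in> param_space n"
  unfolding param_space_def frame_tuple_def is_frame_def codim2_subspaces_def
  using frame_form_carrier[of n c] by (intro restrict_PiE_iff[THEN iffD2]) blast

lemma param_space_has_frame:
  assumes "W \<in> param_space n"
  obtains c where "is_frame n c" "frame_tuple n c = W"
proof -
  have "\<forall>i\<in>{..n}. \<exists>l m. W i = zero_locus2 n l m \<and> l \<in> carrier_vec (Suc n) \<and>
      m \<in> carrier_vec (Suc n) \<and> indep2 n l m"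
    using assms by (fastforce simp: param_space_def codim2_subspaces_def)
  then obtain l m where lm: "\<And>i. i \<le> n \<Longrightarrow> W i = zero_locus2 n (l i) (m i) \<and>
      l i \<in> carrier_vec (Suc n) \<and> m i \<in> carrier_vec (Suc n) \<and> indep2 n (l i) (m i)"
    by (metis atMost_iff)
  define c where "c = (\<lambda>(i, k :: nat, j). (if k = 0 then l i else m i) $ j)"
  have forms: "frame_form n c i 0 = l i" "frame_form n c i 1 = m i" if "i \<le> n" for i
    using lm[OF that] by (auto simp: frame_form_def c_def)
  show thesis
  proof
    show "is_frame n c" using lm by (simp add: is_frame_def forms del: One_nat_def)
    show "frame_tuple n c = W"
    proof
      fix i
      show "frame_tuple n c i = W i"
        using lm[of i] forms[of i] assms
        by (cases "i \<le> n") (auto simp: frame_tuple_def param_space_def PiE_def extensional_def)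
    qed
  qed
qed

text \<open>Whether some frame of a tuple has nonzero discriminant can be tested on any one frame, by
  running through its changes by arbitrary, possibly singular, 2 by 2 matrices: a singular change
  destroys independence and so has discriminant zero.\<close>

lemma zariski_open_adapted_tuples:
  assumes n: "n \<ge> 1"
  shows "zariski_open n (adapted_tuples n :: (nat \<Rightarrow> 'a::field_char_0 vec set) set)"
  unfolding zariski_open_def
proof (intro conjI exI allI impI)
  show "(adapted_tuples n :: (nat \<Rightarrow> 'a vec set) set) \<subseteq> param_space n"
    using is_frame_of_discr[OF n] frame_tuple_in_param_space by (auto simp: adapted_tuples_def)
  fix c :: "nat \<times> nat \<times> nat \<Rightarrow> 'a" assume c: "is_frame n c"
  show "frame_tuple n c \<in> adapted_tuples n \<longleftrightarrow>
      (\<exists>P\<in>range (frame_discr_poly n). poly_eval c P \<noteq> 0)"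
  proof
    assume "frame_tuple n c \<in> adapted_tuples n"
    then obtain c' where c': "frame_tuple n c' = frame_tuple n c" "frame_discr n c' \<noteq> 0"
      by (auto simp: adapted_tuples_def)
    from frames_of_same_tuple[OF c c'(1)] obtain h where
      h: "\<forall>i\<le>n. \<forall>k<2. \<forall>j\<le>n. c' (i, k, j) = change_frame h c (i, k, j)" ..
    have "frame_discr n c' = frame_discr n (change_frame h c)"
      by (rule frame_discr_cong) (use h in blast)
    with c'(2) have "poly_eval c (frame_discr_poly n h) \<noteq> 0"
      by (simp add: poly_eval_frame_discr_poly)
    then show "\<exists>P\<in>range (frame_discr_poly n). poly_eval c P \<noteq> 0" by blast
  next
    assume "\<exists>P\<in>range (frame_discr_poly n). poly_eval c P \<noteq> 0"
    then obtain h where h: "frame_discr n (change_frame h c) \<noteq> 0"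
      by (auto simp: poly_eval_frame_discr_poly)
    have "frame_tuple n (change_frame h c) = frame_tuple n c"
      by (rule frame_tuple_change_frame[OF is_frame_of_discr[OF n h]])
    moreover have "frame_tuple n (change_frame h c) \<in> adapted_tuples n"
      unfolding adapted_tuples_def using h by blast
    ultimately show "frame_tuple n c \<in> adapted_tuples n" by simp
  qed
qed

text \<open>The frames form an open subset of an affine space over an infinite field, which is
  irreducible: a product of two nonzero polynomials has a nonzero value.\<close>

lemma zariski_dense_adapted_tuples:
  assumes n: "n \<ge> 1"
  shows "zariski_dense n (adapted_tuples n :: (nat \<Rightarrow> 'a::field_char_0 vec set) set)"
  unfolding zariski_dense_def
proof (intro allI impI)
  fix V :: "(nat \<Rightarrow> 'a vec set) set" assume V: "zariski_open n V" "V \<noteq> {}"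
  from V(1) obtain S :: "(nat \<times> nat \<times> nat, 'a) mpoly set" where sub: "V \<subseteq> param_space n" and
    S: "\<And>c. is_frame n c \<Longrightarrow> frame_tuple n c \<in> V \<longleftrightarrow> (\<exists>P\<in>S. poly_eval c P \<noteq> 0)"
    unfolding zariski_open_def by blast
  from V(2) sub obtain W where W: "W \<in> V" "W \<in> param_space n" by blast
  then obtain c0 where "is_frame n c0" "frame_tuple n c0 = W"
    using param_space_has_frame by blast
  with S W obtain P where P: "P \<in> S" "poly_eval c0 P \<noteq> 0" by blast
  \<comment> \<open>The identity change of frame, so that the polynomial is the discriminant itself.\<close>
  define D :: "(nat \<times> nat \<times> nat, 'a) mpoly" where
    "D = frame_discr_poly n (\<lambda>i k l. if k = l then 1 else 0)"
  have D: "poly_eval c D = frame_discr n c" for c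
    unfolding D_def poly_eval_frame_discr_poly
    by (rule frame_discr_cong) (auto simp: change_frame_def less_2_cases_iff)
  have "P \<noteq> 0" using P(2) by auto
  moreover have "D \<noteq> 0"
  proof
    assume "D = 0"
    then show False
      using D[of "\<lambda>(i, k, j). if k = 0 then (if i = j then 1 else 0) else 1"]
      by (simp add: frame_discr_standard)
  qed
  \<comment> \<open>The lexicographic order of the index triples orders the monomials, so leading monomials multiply.\<close>
  ultimately have "P * D \<noteq> 0" by simp
  then obtain c where "poly_eval c (P * D) \<noteq> 0"
    using poly_eval_eq_0_imp by blast
  then have c: "poly_eval c P \<noteq> 0" "frame_discr n c \<noteq> 0"
    by (auto simp: poly_eval.hom_mult D)
  have "frame_tuple n c \<in> V"
    using S[OF is_frame_of_discr[OF n c(2)]] P(1) c(1) by blast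
  moreover have "frame_tuple n c \<in> adapted_tuples n"
    using c(2) by (auto simp: adapted_tuples_def)
  ultimately show "adapted_tuples n \<inter> V \<noteq> {}" by blast
qed

theorem proposition4p1:
  fixes n :: nat
  assumes "n \<ge> 2"
  shows "\<exists>U :: (nat \<Rightarrow> 'a::field_char_0 vec set) set.
    zariski_open n U \<and> zariski_dense n U \<and>
    (\<forall>W\<in>U.
       (\<exists>A a. adapted_coordinates n W A a) \<and>
       (\<forall>A a. adapted_coordinates n W A a \<longrightarrow>
          rational_map n (u_map n a) \<and>
          birational n (u_map n a) \<and>
          inverse_rational_maps n (u_map n a) (v_map n a)))"
proof (intro exI[of _ "adapted_tuples n"] conjI ballI allI impI)
  have n: "n \<ge> 1" using assms by simp
  show "zariski_open n (adapted_tuples n :: (nat \<Rightarrow> 'a vec set) set)"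
    by (rule zariski_open_adapted_tuples[OF n])
  show "zariski_dense n (adapted_tuples n :: (nat \<Rightarrow> 'a vec set) set)"
    by (rule zariski_dense_adapted_tuples[OF n])
  fix W :: "nat \<Rightarrow> 'a vec set" assume "W \<in> adapted_tuples n"
  then obtain c where "W = frame_tuple n c" "frame_discr n c \<noteq> 0"
    by (auto simp: adapted_tuples_def)
  then show "\<exists>A a. adapted_coordinates n W A a"
    using adapted_coordinates_of_discr[OF n] by blast
  fix A a assume "adapted_coordinates n W A a"
  then have "offdiag_nonzero n a"
    by (simp add: adapted_coordinates_def offdiag_nonzero_def)
  then show inv: "inverse_rational_maps n (u_map n a) (v_map n a)"
    by (rule inverse_u_map_v_map[OF n])
  then show "birational n (u_map n a)"
    by (auto simp: birational_def)
  from inv show "rational_map n (u_map n a)"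
    by (simp add: inverse_rational_maps_def)
qed

end
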